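(* Let $g_0,g_1,\dots,g_m\in C^\infty(\mathbb{R}^n;\mathbb{R}^n)$ be complete vector fields with flows $G_0,G_1,\dots,G_m$. Let $x^*\in\mathbb{R}^n$, $\gamma>0$, $T>0$, $a_1,\dots,a_m>0$, $K_1>0$. Assume: ($I_1$) $g_1,\dots,g_m$ are in involution over the reals on $B(x^*,3\gamma)$, and $[g_0,g_i](x)=0$ for all $x\in B(x^*,3\gamma)$, $1\le i\le m$; ($I_2$) $u\in\mathcal{U}_a$, each $u_i(\cdot,\lambda)$ ($1\le i\le m$) has bounded variation on $[0,T]$, and for all $x\in B(x^*,3\gamma)$, $|t|\le T$, $|t_i|\le a_i$, $1\le i\le m$, one has $|G_0(t)[x]-x|\le\frac{\gamma}{2(m+1)}$ and $|G_i(t_i)[x]-x|\le\frac{\gamma}{2(m+1)}$. Define $y^u(t,\lambda)=G_0(t)\circ G(u(t,\lambda))[\lambda]$ for $t\in[0,T]$, $\lambda\in B(x^*,2\gamma)$. Then $y^u(t,\lambda)\in B(x^*,3\gamma)$ for all $t\in[0,T]$, $\lambda\in B(x^*,2\gamma)$, and for each $\lambda\in B(x^*,2\gamma)$ $$d_t y^u(t,\lambda)=g_0(y^u(t,\lambda))\,dt+\sum_{i=1}^m g_i(y^u(t,\lambda))\,d_t\beta_i^u(t,\lambda),\quad t\in[t_k,t_{k+1}),\ 0\le k\le N-1,\qquad y^u(0,\lambda)=\lambda .$$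
   Context: $B(x^*,r)$ is the closed ball of radius $r$ centered at $x^*$ in $\mathbb{R}^n$. $G_i(t)[x]$ is the flow of $g_i$ at time $t$ started at $x$. Put $\square=\prod_{i=1}^m[-a_i,a_i]\subset\mathbb{R}^m$ and, for $p=(t_1,\dots,t_m)\in\square$, $G(p)[x]=G_1(t_1)\circ\dots\circ G_m(t_m)[x]$. Involution over the reals on $B(x^*,3\gamma)$: there are constants $\gamma^{ij}_k\in\mathbb{R}$ such that the Lie brackets satisfy $[g_i,g_j](x)=\sum_{k=1}^m\gamma^{ij}_k g_k(x)$ for all $x\in B(x^*,3\gamma)$, $1\le i,j\le m$. $\mathcal{U}_a$ (admissible perturbations) is the set of all maps $u:[0,\infty)\times\mathbb{R}^n\to\square$, piecewise right-continuous in $t\ge0$, with $u(0,\lambda)=0$, $u(t,\cdot)\in C^1_b(\mathbb{R}^n;\mathbb{R}^m)$ and $|\partial_\lambda u_i(t,\lambda)|\le K_1$ for all $t\ge0$, $\lambda\in\mathbb{R}^n$, $1\le i\le m$. The intervals $[t_k,t_{k+1})\subseteq[0,T]$, $0\le k\le N-1$ ($0=t_0<\dots<t_N=T$), are the continuity intervals of $u$ in $t$. $A(p)=[b_1\ b_2(t_1)\ \dots\ b_m(t_1,\dots,t_{m-1})]$ is an $m\times m$ matrix with $C^\infty$ columns $b_j=(b_j^1,\dots,b_j^m)^{\top}$ on $\square$, $b_1=(1,0,\dots,0)^{\top}$, $A(0)=I_m$, giving the algebraic representation of the gradient system solved by $y=G(p)[\lambda]$: for $p\in\square$, $\lambda\in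 B(x^*,2\gamma)$, $\partial_{t_j}y=Y_j(t_1,\dots,t_{j-1};y)$ with $Y_j(t_1,\dots,t_{j-1};y)=\sum_{i=1}^m b_j^i(t_1,\dots,t_{j-1})g_i(y)$, $1\le j\le m$, $y(0)=\lambda$. (Such an $A$ is obtained from the involution hypothesis; it is fixed.) Define $$\alpha_{ij}^u(t,\lambda)=\int_0^t b_j^i(u_1(s,\lambda),\dots,u_{j-1}(s,\lambda))\,d_su_j(s,\lambda),\qquad \beta_i^u(t,\lambda)=\sum_{j=1}^m\alpha_{ij}^u(t,\lambda).$$ An equation between differentials $d_t$ on $[t_k,t_{k+1})$ is understood in integrated (Lebesgue–Stieltjes in $t$, $\lambda$ fixed) form: equality of the integrals over every $[t',t'']\subset[t_k,t_{k+1})$. *)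

theory Defs
  imports "HOL-Analysis.Analysis"
begin

text \<open>
  The index set \<open>{1, \<dots>, m}\<close> is a finite linearly ordered type \<open>'m\<close> with \<open>m = CARD('m)\<close>; its
  order is the order of composition of the flows and the order behind \<open>t\<^sub>1, \<dots>, t\<^bsub>j-1\<^esub>\<close>.
\<close>

subsection \<open>Smooth maps, Lie brackets, flows\<close>

text \<open>On an open set of a Euclidean space the following is the class \<open>C\<^sup>k\<close>: the derivative is handled
  through its values \<open>f'(x) v\<close>, one for each direction \<open>v\<close>.\<close>

fun Ck_on :: "nat \<Rightarrow> 'a::euclidean_space set \<Rightarrow> ('a \<Rightarrow> 'b::euclidean_space) \<Rightarrow> bool" where
  "Ck_on 0 S f \<longleftrightarrow> continuous_on S f"
| "Ck_on (Suc k) S f \<longleftrightarrow>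
     (\<forall>x\<in>S. f differentiable (at x)) \<and>
     (\<forall>v. Ck_on k S (\<lambda>x. frechet_derivative f (at x) v))"

text \<open>On a set that need not be open, such as a closed box, smooth means: restriction of a smooth map
  on an open neighbourhood.\<close>

definition C_infinity_on :: "'a::euclidean_space set \<Rightarrow> ('a \<Rightarrow> 'b::euclidean_space) \<Rightarrow> bool" where
  "C_infinity_on S f \<longleftrightarrow>
     (\<exists>U h. open U \<and> S \<subseteq> U \<and> (\<forall>k. Ck_on k U h) \<and> (\<forall>x\<in>S. f x = h x))"

definition C1_bounded :: "('a::euclidean_space \<Rightarrow> 'b::euclidean_space) \<Rightarrow> bool" where
  "C1_bounded f \<longleftrightarrow>
     Ck_on 1 UNIV f \<and> bounded (range f) \<and>
     bounded (range (\<lambda>x. onorm (frechet_derivative f (at x))))"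

definition lie_bracket ::
  "('a::euclidean_space \<Rightarrow> 'a) \<Rightarrow> ('a \<Rightarrow> 'a) \<Rightarrow> 'a \<Rightarrow> 'a" where
  "lie_bracket f h x = frechet_derivative h (at x) (f x) - frechet_derivative f (at x) (h x)"

definition involution_over_reals_on ::
  "'a::euclidean_space set \<Rightarrow> ('m::finite \<Rightarrow> 'a \<Rightarrow> 'a) \<Rightarrow> bool" where
  "involution_over_reals_on S g \<longleftrightarrow>
     (\<exists>c :: 'm \<Rightarrow> 'm \<Rightarrow> 'm \<Rightarrow> real. \<forall>x\<in>S. \<forall>i j.
        lie_bracket (g i) (g j) x = (\<Sum>k\<in>UNIV. c i j k *\<^sub>R g k x))"

text \<open>\<open>G\<close> is the flow of \<open>g\<close>, defined for all times. The existence of such a \<open>G\<close> is completeness of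
  \<open>g\<close>; for smooth \<open>g\<close> it is unique.\<close>

definition is_flow :: "('a::euclidean_space \<Rightarrow> 'a) \<Rightarrow> (real \<Rightarrow> 'a \<Rightarrow> 'a) \<Rightarrow> bool" where
  "is_flow g G \<longleftrightarrow>
     (\<forall>x. G 0 x = x \<and> (\<forall>t. ((\<lambda>s. G s x) has_vector_derivative g (G t x)) (at t)))"

text \<open>\<open>G(p)[x] = G\<^sub>1(t\<^sub>1) \<circ> \<dots> \<circ> G\<^sub>m(t\<^sub>m)[x]\<close>; the flow with the largest index acts first.\<close>

definition flow_comp ::
  "('m \<Rightarrow> real \<Rightarrow> 'a \<Rightarrow> 'a) \<Rightarrow> real^'m::{finite,linorder} \<Rightarrow> 'a \<Rightarrow> 'a" where
  "flow_comp G p x = foldr (\<lambda>i. G i (p $ i)) (sorted_list_of_set UNIV) x"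


subsection \<open>Functions of bounded variation and Lebesgue--Stieltjes integrals\<close>

definition variation_sums :: "(real \<Rightarrow> real) \<Rightarrow> real \<Rightarrow> real \<Rightarrow> real set" where
  "variation_sums F a b =
     {(\<Sum>k<n. \<bar>F (s (Suc k)) - F (s k)\<bar>) | (n::nat) s.
        s 0 = a \<and> s n = b \<and> (\<forall>k<n. s k \<le> s (Suc k))}"

definition bounded_variation_on :: "(real \<Rightarrow> real) \<Rightarrow> real \<Rightarrow> real \<Rightarrow> bool" where
  "bounded_variation_on F a b \<longleftrightarrow> bdd_above (variation_sums F a b)"

definition total_variation :: "(real \<Rightarrow> real) \<Rightarrow> real \<Rightarrow> real \<Rightarrow> real" where
  "total_variation F a b = Sup (variation_sums F a b)"

text \<open>The Jordan decomposition of \<open>dF\<close> on \<open>[a, b]\<close>: the measures of the positive and of the negative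
  variation of \<open>F\<close>. Only the restriction of \<open>F\<close> to \<open>[a, b]\<close> enters, so that neither measure has an
  atom at \<open>a\<close>.\<close>

definition pos_variation_measure :: "(real \<Rightarrow> real) \<Rightarrow> real \<Rightarrow> real \<Rightarrow> real measure" where
  "pos_variation_measure F a b = interval_measure
     (\<lambda>t. let r = max a (min b t) in (total_variation F a r + (F r - F a)) / 2)"

definition neg_variation_measure :: "(real \<Rightarrow> real) \<Rightarrow> real \<Rightarrow> real \<Rightarrow> real measure" where
  "neg_variation_measure F a b = interval_measure
     (\<lambda>t. let r = max a (min b t) in (total_variation F a r - (F r - F a)) / 2)"

definition LS_integrable ::
  "(real \<Rightarrow> 'b::euclidean_space) \<Rightarrow> (real \<Rightarrow> real) \<Rightarrow> real \<Rightarrow> real \<Rightarrow> bool" where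
  "LS_integrable f F a b \<longleftrightarrow>
     bounded_variation_on F a b \<and> (\<forall>t\<in>{a..<b}. continuous (at_right t) F) \<and>
     set_integrable (pos_variation_measure F a b) {a<..b} f \<and>
     set_integrable (neg_variation_measure F a b) {a<..b} f"

definition LS_integral ::
  "(real \<Rightarrow> 'b::euclidean_space) \<Rightarrow> (real \<Rightarrow> real) \<Rightarrow> real \<Rightarrow> real \<Rightarrow> 'b" where
  "LS_integral f F a b =
     set_lebesgue_integral (pos_variation_measure F a b) {a<..b} f -
     set_lebesgue_integral (neg_variation_measure F a b) {a<..b} f"


subsection \<open>Admissible perturbations\<close>

text \<open>\<open>0 = \<tau>\<^sub>0 < \<dots> < \<tau>\<^sub>N = T\<close>, the same partition for all parameters \<open>\<xi>\<close>, with \<open>u(\<cdot>, \<xi>)\<close> continuous on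
  each \<open>[\<tau>\<^sub>k, \<tau>\<^bsub>k+1\<^esub>)\<close>.\<close>

definition continuity_partition ::
  "(real \<Rightarrow> 'a \<Rightarrow> 'b::topological_space) \<Rightarrow> real \<Rightarrow> nat \<Rightarrow> (nat \<Rightarrow> real) \<Rightarrow> bool" where
  "continuity_partition u T N \<tau> \<longleftrightarrow>
     \<tau> 0 = 0 \<and> \<tau> N = T \<and>
     (\<forall>k<N. \<tau> k < \<tau> (Suc k) \<and> (\<forall>\<xi>. continuous_on {\<tau> k..<\<tau> (Suc k)} (\<lambda>t. u t \<xi>)))"

definition piecewise_right_continuous ::
  "(real \<Rightarrow> 'a \<Rightarrow> 'b::topological_space) \<Rightarrow> bool" where
  "piecewise_right_continuous u \<longleftrightarrow> (\<forall>T>0. \<exists>N \<tau>. continuity_partition u T N \<tau>)"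

text \<open>The box \<open>\<Prod>\<^sub>i [-a\<^sub>i, a\<^sub>i]\<close> is \<open>cbox (- a) a\<close>. Values of \<open>u\<close> at negative times are irrelevant.\<close>

definition admissible_perturbations ::
  "real^'m::finite \<Rightarrow> real \<Rightarrow> (real \<Rightarrow> real^'n \<Rightarrow> real^'m) set" where
  "admissible_perturbations a K\<^sub>1 =
     {u. (\<forall>t\<ge>0. \<forall>\<xi>. u t \<xi> \<in> cbox (- a) a) \<and>
         piecewise_right_continuous u \<and>
         (\<forall>\<xi>. u 0 \<xi> = 0) \<and>
         (\<forall>t\<ge>0. C1_bounded (u t)) \<and>
         (\<forall>t\<ge>0. \<forall>\<xi> i. onorm (frechet_derivative (\<lambda>\<eta>. u t \<eta> $ i) (at \<xi>)) \<le> K\<^sub>1)}"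


subsection \<open>The gradient system and its algebraic representation\<close>

text \<open>The column \<open>b\<^sub>j\<close> is a function of \<open>p\<close> that depends on the coordinates of index less than \<open>j\<close>
  only; its component \<open>b\<^sub>j\<^sup>i\<close> is \<open>A p $ i $ j\<close>. The partial derivative at a boundary point of the box
  is the one taken inside the box.\<close>

definition gradient_representation ::
  "('m \<Rightarrow> real^'n \<Rightarrow> real^'n) \<Rightarrow> ('m \<Rightarrow> real \<Rightarrow> real^'n \<Rightarrow> real^'n) \<Rightarrow>
   real^'m::{finite,linorder} \<Rightarrow> (real^'n) set \<Rightarrow>
   (real^'m::{finite,linorder} \<Rightarrow> real^'m::{finite,linorder}^'m::{finite,linorder}) \<Rightarrow> bool" where
  "gradient_representation g G a S A \<longleftrightarrow>
     (\<forall>j. C_infinity_on (cbox (- a) a) (\<lambda>p. column j (A p))) \<and>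
     (\<forall>j. \<forall>p\<in>cbox (- a) a. \<forall>q\<in>cbox (- a) a.
        (\<forall>i<j. p $ i = q $ i) \<longrightarrow> column j (A p) = column j (A q)) \<and>
     (\<forall>p\<in>cbox (- a) a. column (Min UNIV) (A p) = axis (Min UNIV) 1) \<and>
     A 0 = mat 1 \<and>
     (\<forall>\<xi>\<in>S.
        flow_comp G 0 \<xi> = \<xi> \<and>
        (\<forall>p\<in>cbox (- a) a. \<forall>j.
           ((\<lambda>s. flow_comp G (\<chi> i. if i = j then s else p $ i) \<xi>) has_vector_derivative
              (\<Sum>i\<in>UNIV. A p $ i $ j *\<^sub>R g i (flow_comp G p \<xi>)))
           (at (p $ j) within {- a $ j..a $ j})))"

definition alpha ::
  "(real^'m \<Rightarrow> real^'m^'m) \<Rightarrow> (real \<Rightarrow> real^'n \<Rightarrow> real^'m::finite) \<Rightarrow>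
   'm \<Rightarrow> 'm \<Rightarrow> real \<Rightarrow> real^'n \<Rightarrow> real" where
  "alpha A u i j t \<xi> = LS_integral (\<lambda>s. A (u s \<xi>) $ i $ j) (\<lambda>s. u s \<xi> $ j) 0 t"

definition beta ::
  "(real^'m \<Rightarrow> real^'m^'m) \<Rightarrow> (real \<Rightarrow> real^'n \<Rightarrow> real^'m::finite) \<Rightarrow>
   'm \<Rightarrow> real \<Rightarrow> real^'n \<Rightarrow> real" where
  "beta A u i t \<xi> = (\<Sum>j\<in>UNIV. alpha A u i j t \<xi>)"

text \<open>\<open>dy = g\<^sub>0(y) dt + \<Sum>\<^sub>i g\<^sub>i(y) d\<beta>\<^sub>i\<close> on \<open>I\<close>, in integrated form. The differentials are those of the
  functions restricted to \<open>I\<close>: a jump at the left end point of \<open>I\<close> does not count. Existence of the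
  integrals is part of the assertion.\<close>

definition satisfies_differential_equation_on ::
  "real set \<Rightarrow> (real^'n \<Rightarrow> real^'n) \<Rightarrow> ('m::finite \<Rightarrow> real^'n \<Rightarrow> real^'n) \<Rightarrow>
   ('m \<Rightarrow> real \<Rightarrow> real) \<Rightarrow> (real \<Rightarrow> real^'n) \<Rightarrow> bool" where
  "satisfies_differential_equation_on I g\<^sub>0 g \<beta> y \<longleftrightarrow>
     (\<forall>t' t''. t' \<le> t'' \<and> {t'..t''} \<subseteq> I \<longrightarrow>
        set_integrable lborel {t'..t''} (\<lambda>s. g\<^sub>0 (y s)) \<and>
        (\<forall>i. LS_integrable (\<lambda>s. g i (y s)) (\<beta> i) t' t'') \<and>
        y t'' - y t' =
          set_lebesgue_integral lborel {t'..t''} (\<lambda>s. g\<^sub>0 (y s)) +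
          (\<Sum>i\<in>UNIV. LS_integral (\<lambda>s. g i (y s)) (\<beta> i) t' t''))"

end

theory Submission
  imports Defs
begin

text \<open>
  Fix \<open>\<xi>\<close> and put \<open>F(t, p) = G\<^sub>0(t)[G(p)[\<xi>]]\<close>, so that \<open>y(t) = F(t, u(t))\<close>. The theorem is the chain rule
  for the \<open>C\<^sup>1\<close> map \<open>F\<close> along the path \<open>t \<mapsto> (t, u(t))\<close>, which is continuous and of bounded variation on
  every continuity interval of \<open>u\<close>.

  The partial derivatives of \<open>F\<close> are known. In \<open>t\<close> it is \<open>g\<^sub>0(F)\<close>, by definition of the flow. In \<open>p\<^sub>j\<close>
  it is \<open>\<Sum>\<^sub>i A\<^sub>i\<^sub>j(p) g\<^sub>i(F)\<close>: for \<open>t = 0\<close> this is the gradient representation, and since each \<open>g\<^sub>i\<close>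
  commutes with \<open>g\<^sub>0\<close>, the flow of \<open>g\<^sub>0\<close> carries a curve with velocity
  \<open>X = \<Sum>\<^sub>i A\<^sub>i\<^sub>j(p) g\<^sub>i\<close> at a point to a curve with velocity \<open>X\<close> at the image point
  (\<open>commuting_flow_transports_derivative\<close>). The coefficients \<open>A\<^sub>i\<^sub>j(p)\<close> are frozen at \<open>p\<close> here, which is why
  commutation with the individual \<open>g\<^sub>i\<close> suffices. The displacement bounds keep every point within
  \<open>5\<gamma>/2\<close> of the centre, hence in the interior of the ball on which the brackets vanish.
  Continuity of the partial derivatives on the compact set \<open>[0, T] \<times> \<box>\<close> then gives a first-order
  expansion of \<open>F\<close> with an error that is uniformly small (\<open>uniform_expansion_on_box\<close>).

  Stieltjes integrals behave well under such expansions: an integral of \<open>f\<close> against \<open>dU\<close> over a short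
  interval \<open>[s, t]\<close> equals \<open>f(s) (U(t) - U(s))\<close> up to a small multiple of the variation of \<open>U\<close> on \<open>[s, t]\<close>
  (\<open>LS_integral_approx\<close>). Applied to \<open>d\<beta>\<^sub>i = \<Sum>\<^sub>j A\<^sub>i\<^sub>j(u) du\<^sub>j\<close> and then to \<open>g\<^sub>i(y) d\<beta>\<^sub>i\<close>, this shows that the
  two sides of the claimed equation have increments over \<open>[s, t]\<close> that differ by at most \<open>\<epsilon>\<close> times the
  increment of one fixed nondecreasing function. Summing over a fine partition and letting \<open>\<epsilon>\<close> tend to \<open>0\<close>,
  the two sides agree (\<open>LS_equation_from_expansion\<close>).
\<close>

section \<open>Total variation\<close>

lemma sum_increments_le_telescope:
  fixes s :: "nat \<Rightarrow> real" and F W :: "real \<Rightarrow> real"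
  assumes "\<And>k. k < n \<Longrightarrow> \<bar>F (s (Suc k)) - F (s k)\<bar> \<le> W (s (Suc k)) - W (s k)"
  shows "(\<Sum>k<n. \<bar>F (s (Suc k)) - F (s k)\<bar>) \<le> W (s n) - W (s 0)"
proof -
  have "(\<Sum>k<n. \<bar>F (s (Suc k)) - F (s k)\<bar>) \<le> (\<Sum>k<n. W (s (Suc k)) - W (s k))"
    using assms by (intro sum_mono) auto
  also have "\<dots> = W (s n) - W (s 0)"
    by (rule sum_lessThan_telescope)
  finally show ?thesis .
qed

lemma partition_mono:
  fixes s :: "nat \<Rightarrow> real"
  assumes "\<forall>k<n. s k \<le> s (Suc k)" "i \<le> j" "j \<le> n"
  shows "s i \<le> s j"
  using assms(2,3)
proof (induction j rule: dec_induct)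
  case (step j)
  then show ?case using assms(1) by (smt (verit) Suc_le_lessD less_or_eq_imp_le)
qed simp

lemma variation_sumsE:
  assumes "v \<in> variation_sums F a b"
  obtains s and n :: nat where "v = (\<Sum>k<n. \<bar>F (s (Suc k)) - F (s k)\<bar>)" "s 0 = a" "s n = b"
    "\<forall>k<n. s k \<le> s (Suc k)"
  using assms unfolding variation_sums_def mem_Collect_eq by (elim exE conjE)

lemma increment_in_variation_sums:
  assumes "a \<le> b" shows "\<bar>F b - F a\<bar> \<in> variation_sums F a b"
  unfolding variation_sums_def mem_Collect_eq
  using assms by (intro exI[of _ "1::nat"] exI[of _ "\<lambda>k. if k = 0 then a else b"]) auto

text \<open>
  Domination of the increments of \<open>F\<close> by those of a single function \<open>W\<close> makes every variation
  sum telescope.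
\<close>

lemma bounded_variation_on_dominated:
  assumes "a \<le> b" "\<And>c d. a \<le> c \<Longrightarrow> c \<le> d \<Longrightarrow> d \<le> b \<Longrightarrow> \<bar>F d - F c\<bar> \<le> W d - W c"
  shows "bounded_variation_on F a b" "total_variation F a b \<le> W b - W a"
proof -
  have *: "v \<le> W b - W a" if "v \<in> variation_sums F a b" for v
  proof -
    obtain s and n :: nat where s: "v = (\<Sum>k<n. \<bar>F (s (Suc k)) - F (s k)\<bar>)" "s 0 = a" "s n = b"
        "\<forall>k<n. s k \<le> s (Suc k)"
      using \<open>v \<in> _\<close> by (rule variation_sumsE)
    have "a \<le> s k" "s k \<le> b" if "k \<le> n" for k
      using partition_mono[OF s(4), of 0 k] partition_mono[OF s(4), of k n] s that by auto
    then show ?thesis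
      using sum_increments_le_telescope[of n F s W] s assms(2) by (metis Suc_leI less_imp_le_nat)
  qed
  then show "bounded_variation_on F a b"
    unfolding bounded_variation_on_def bdd_above_def by blast
  have "variation_sums F a b \<noteq> {}"
    using increment_in_variation_sums[OF assms(1)] by blast
  then show "total_variation F a b \<le> W b - W a"
    unfolding total_variation_def using * by (rule cSup_least)
qed

lemma increment_le_total_variation:
  assumes "bounded_variation_on F a b" "a \<le> b"
  shows "\<bar>F b - F a\<bar> \<le> total_variation F a b"
  unfolding total_variation_def
  using assms increment_in_variation_sums[of a b F]
  by (intro cSup_upper) (auto simp: bounded_variation_on_def)

lemma total_variation_refl [simp]: "total_variation F a a = 0"
proof (rule order.antisym)
  have *: "\<bar>F d - F c\<bar> \<le> 0 - 0" if "a \<le> c" "c \<le> d" "d \<le> a" for c d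
  proof -
    have "c = d" using that by linarith
    then show ?thesis by simp
  qed
  show "total_variation F a a \<le> 0"
    using bounded_variation_on_dominated(2)[of a a F "\<lambda>_. 0", OF _ *] by simp
  show "0 \<le> total_variation F a a"
    using increment_le_total_variation[of F a a] bounded_variation_on_dominated(1)[of a a F "\<lambda>_. 0", OF _ *]
    by simp
qed

lemma variation_sums_append:
  assumes "v \<in> variation_sums F a b" "w \<in> variation_sums F b c"
  shows "v + w \<in> variation_sums F a c"
proof -
  obtain s and n :: nat where s: "v = (\<Sum>k<n. \<bar>F (s (Suc k)) - F (s k)\<bar>)" "s 0 = a" "s n = b"
      "\<forall>k<n. s k \<le> s (Suc k)"
    using assms(1) by (rule variation_sumsE)
  obtain r and m :: nat where r: "w = (\<Sum>k<m. \<bar>F (r (Suc k)) - F (r k)\<bar>)" "r 0 = b" "r m = c"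
      "\<forall>k<m. r k \<le> r (Suc k)"
    using assms(2) by (rule variation_sumsE)
  define q where "q k = (if k \<le> n then s k else r (k - n))" for k
  have q: "q (n + k) = r k" for k
    using s(3) r(2) by (cases "k = 0") (auto simp: q_def)
  have "(\<Sum>k<n+m. \<bar>F (q (Suc k)) - F (q k)\<bar>) =
      (\<Sum>k<n. \<bar>F (q (Suc k)) - F (q k)\<bar>) + (\<Sum>k<m. \<bar>F (q (Suc (n+k))) - F (q (n + k))\<bar>)"
    by (induction m) (auto simp: add_ac)
  also have "(\<Sum>k<n. \<bar>F (q (Suc k)) - F (q k)\<bar>) = v"
    unfolding s(1) by (intro sum.cong) (auto simp: q_def)
  also have "(\<Sum>k<m. \<bar>F (q (Suc (n+k))) - F (q (n + k))\<bar>) = w"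
    unfolding r(1) using q q[of "Suc _"] by (intro sum.cong) auto
  finally have "v + w = (\<Sum>k<n+m. \<bar>F (q (Suc k)) - F (q k)\<bar>)" ..
  moreover have "q k \<le> q (Suc k)" if "k < n + m" for k
  proof (cases "k < n")
    case True then show ?thesis using s(4) by (auto simp: q_def)
  next
    case False
    then obtain l where "k = n + l" "l < m" using \<open>k < n + m\<close> by (metis add_less_cancel_left le_Suc_ex not_less)
    then show ?thesis using q q[of "Suc l"] r(4) by auto
  qed
  moreover have "q 0 = a" "q (n + m) = c" using q[of m] r s by (auto simp: q_def)
  ultimately show ?thesis unfolding variation_sums_def by blast
qed

lemma bounded_variation_on_subinterval:
  assumes "bounded_variation_on F a b" "a \<le> c" "c \<le> d" "d \<le> b"
  shows "bounded_variation_on F c d"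
proof -
  obtain M where M: "\<And>v. v \<in> variation_sums F a b \<Longrightarrow> v \<le> M"
    using assms(1) unfolding bounded_variation_on_def bdd_above_def by blast
  have "v \<le> M" if "v \<in> variation_sums F c d" for v
    using M[OF variation_sums_append[OF variation_sums_append[OF increment_in_variation_sums that]
        increment_in_variation_sums], OF assms(2,4)] by (smt (verit))
  then show ?thesis unfolding bounded_variation_on_def bdd_above_def by blast
qed

text \<open>
  Concatenating partitions gives \<open>\<ge>\<close>. For \<open>\<le>\<close> a partition of \<open>[a, c]\<close> need not contain \<open>b\<close>; instead of
  refining it, the glued function \<open>W\<close> is shown to dominate the increments of \<open>F\<close>, also across \<open>b\<close>.
\<close>

lemma total_variation_add:
  assumes bv: "bounded_variation_on F a c" and "a \<le> b" "b \<le> c"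
  shows "total_variation F a c = total_variation F a b + total_variation F b c"
proof (rule antisym)
  have super: "total_variation F x y + total_variation F y z \<le> total_variation F x z"
    if "a \<le> x" "x \<le> y" "y \<le> z" "z \<le> c" for x y z
  proof -
    have bdd: "bdd_above (variation_sums F x z)"
      using bounded_variation_on_subinterval[OF bv, of x z] that by (auto simp: bounded_variation_on_def)
    have up: "v + w \<le> total_variation F x z"
      if "v \<in> variation_sums F x y" "w \<in> variation_sums F y z" for v w
      unfolding total_variation_def by (rule cSup_upper[OF variation_sums_append[OF that] bdd])
    have "total_variation F x y \<le> total_variation F x z - w" if "w \<in> variation_sums F y z" for w
      unfolding total_variation_def[of F x y]
      using increment_in_variation_sums[OF \<open>x \<le> y\<close>, of F] up that by (intro cSup_least) (auto simp: algebra_simps)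
    then have "total_variation F y z \<le> total_variation F x z - total_variation F x y"
      unfolding total_variation_def[of F y z]
      using increment_in_variation_sums[OF \<open>y \<le> z\<close>, of F] by (intro cSup_least) (auto simp: algebra_simps)
    then show ?thesis by simp
  qed
  then show "total_variation F a b + total_variation F b c \<le> total_variation F a c"
    using assms by auto
  have inc: "\<bar>F y - F x\<bar> \<le> total_variation F x y" if "a \<le> x" "x \<le> y" "y \<le> c" for x y
    using that increment_le_total_variation bounded_variation_on_subinterval[OF bv] by blast
  \<comment> \<open>Of the three positions of \<open>b\<close> relative to an increment, the crossing one splits it at \<open>b\<close>.\<close>
  define W where "W t = (if t \<le> b then total_variation F a t
      else total_variation F a b + total_variation F b t)" for t
  have "\<bar>F y - F x\<bar> \<le> W y - W x" if "a \<le> x" "x \<le> y" "y \<le> c" for x y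
  proof -
    consider "y \<le> b" | "x \<le> b" "b < y" | "b < x" by linarith
    then show ?thesis
    proof cases
      case 1
      then show ?thesis using inc[of x y] super[of a x y] that by (auto simp: W_def)
    next
      case 2
      then show ?thesis using inc[of x b] inc[of b y] super[of a x b] that by (auto simp: W_def)
    next
      case 3
      then show ?thesis using inc[of x y] super[of b x y] that assms by (auto simp: W_def)
    qed
  qed
  then have "total_variation F a c \<le> W c - W a"
    using assms by (intro bounded_variation_on_dominated(2)) auto
  also have "\<dots> = total_variation F a b + total_variation F b c"
    using assms by (cases "b = c") (auto simp: W_def)
  finally show "total_variation F a c \<le> total_variation F a b + total_variation F b c" .
qed

lemma total_variation_nonneg:
  assumes "bounded_variation_on F a b" "a \<le> b"
  shows "0 \<le> total_variation F a b"
  using increment_le_total_variation[OF assms] by linarith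

lemma continuous_at_right_iff:
  fixes F :: "real \<Rightarrow> real"
  shows "continuous (at_right t) F \<longleftrightarrow>
    (\<forall>e>0. \<exists>d>0. \<forall>r. t < r \<and> r < t + d \<longrightarrow> \<bar>F r - F t\<bar> < e)"
proof -
  have "(\<forall>r\<in>{t<..}. \<bar>r - t\<bar> < d \<longrightarrow> \<bar>F r - F t\<bar> < e) \<longleftrightarrow> (\<forall>r. t < r \<and> r < t + d \<longrightarrow> \<bar>F r - F t\<bar> < e)"
    for d e by (auto simp: abs_if algebra_simps)
  then show ?thesis
    unfolding continuous_within_eps_delta dist_real_def by simp
qed

text \<open>
  Right continuity passes from \<open>F\<close> to its variation: take a partition of \<open>[t, b]\<close> that is almost optimal.
  If \<open>r > t\<close> lies before all its points other than \<open>t\<close>, its sum is at most \<open>|F(r) - F(t)|\<close> plus the variation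
  on \<open>[r, b]\<close>, so that little variation is left for \<open>[t, r]\<close>.
\<close>

lemma total_variation_right_continuous:
  assumes bv: "bounded_variation_on F t b" and "t < b" and rc: "continuous (at_right t) F"
    and "e > 0"
  shows "\<exists>d>0. \<forall>r. t \<le> r \<and> r < t + d \<longrightarrow> r \<le> b \<and> total_variation F t r < e"
proof -
  have "\<exists>v\<in>variation_sums F t b. total_variation F t b - e/2 < v"
    unfolding total_variation_def
    using bv \<open>e > 0\<close> increment_in_variation_sums[of t b F] \<open>t < b\<close>
    by (intro less_cSupD) auto
  then obtain v where v: "v \<in> variation_sums F t b" "total_variation F t b - e/2 < v" by blast
  from v(1) obtain s and n :: nat where s: "total_variation F t b - e/2 < (\<Sum>k<n. \<bar>F (s (Suc k)) - F (s k)\<bar>)"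
      "s 0 = t" "s n = b" "\<forall>k<n. s k \<le> s (Suc k)"
    using v(2) by (elim variation_sumsE) simp
  obtain d1 where d1: "d1 > 0" "\<And>r. t < r \<Longrightarrow> r < t + d1 \<Longrightarrow> \<bar>F r - F t\<bar> < e/2"
    using rc \<open>e > 0\<close> unfolding continuous_at_right_iff by (meson half_gt_zero)
  \<comment> \<open>The partition may stay at \<open>t\<close> for several steps; \<open>m\<close> is its first point after \<open>t\<close>.\<close>
  define m where "m = Min (s ` {k. k \<le> n \<and> t < s k})"
  have fin: "finite (s ` {k. k \<le> n \<and> t < s k})" "s ` {k. k \<le> n \<and> t < s k} \<noteq> {}"
    using s(3) \<open>t < b\<close> by auto
  have m: "t < m" "\<And>k. k \<le> n \<Longrightarrow> t < s k \<Longrightarrow> m \<le> s k" "m \<le> b"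
    using fin Min_in[OF fin] Min_le[OF fin(1)] s(3) \<open>t < b\<close> unfolding m_def by auto
  have main: "total_variation F t r < e" if r: "t < r" "r < t + d1" "r < m" for r
  proof -
    \<comment> \<open>The first partition step that leaves \<open>t\<close> jumps over \<open>r\<close>; \<open>W\<close> charges it with \<open>|F(r) - F(t)|\<close>.\<close>
    define W where "W x = (if x \<le> t then 0 else \<bar>F r - F t\<bar> + total_variation F r x)" for x
    have rb: "r \<le> b" using r m by linarith
    have inc: "\<bar>F y - F x\<bar> \<le> total_variation F x y" if "t \<le> x" "x \<le> y" "y \<le> b" for x y
      using that increment_le_total_variation bounded_variation_on_subinterval[OF bv] by blast
    have "(\<Sum>k<n. \<bar>F (s (Suc k)) - F (s k)\<bar>) \<le> W (s n) - W (s 0)"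
    proof (rule sum_increments_le_telescope)
      fix k assume k: "k < n"
      have sk: "s k \<le> s (Suc k)" "t \<le> s k" "s (Suc k) \<le> b"
        using partition_mono[OF s(4), of 0 k] partition_mono[OF s(4), of "Suc k" n] s k by auto
      consider "s (Suc k) = t" | "s k = t" "t < s (Suc k)" | "t < s k" using sk by linarith
      then show "\<bar>F (s (Suc k)) - F (s k)\<bar> \<le> W (s (Suc k)) - W (s k)"
      proof cases
        case 1 then show ?thesis using sk by (auto simp: W_def)
      next
        case 2 then show ?thesis using inc[of r "s (Suc k)"] r m(2)[of "Suc k"] k sk by (auto simp: W_def)
      next
        case 3
        then have "r < s k" using m(2)[of k] r k by auto
        then show ?thesis
          using inc[of "s k" "s (Suc k)"] sk r
            total_variation_add[OF bounded_variation_on_subinterval[OF bv, of r "s (Suc k)"], of "s k"]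
          by (auto simp: W_def)
      qed
    qed
    then have "total_variation F t b - e/2 < e/2 + total_variation F r b"
      using s(1) d1(2)[OF r(1,2)] r rb \<open>t < b\<close> unfolding s(2,3) W_def by auto
    then show ?thesis using total_variation_add[OF bv, of r] r rb by auto
  qed
  show ?thesis
  proof (intro exI[of _ "min d1 (m - t)"] conjI allI impI)
    fix r assume "t \<le> r \<and> r < t + min d1 (m - t)"
    then have r: "t \<le> r" "r < t + d1" "r < m" by (auto simp: min_def split: if_splits)
    then show "r \<le> b" using m by auto
    show "total_variation F t r < e" using main[of r] r \<open>e > 0\<close> by (cases "r = t") auto
  qed (use d1 m in auto)
qed

section \<open>Lebesgue--Stieltjes integrals against right-continuous integrators\<close>

definition right_continuous_bv :: "(real \<Rightarrow> real) \<Rightarrow> real \<Rightarrow> real \<Rightarrow> bool" where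
  "right_continuous_bv F a b \<longleftrightarrow>
     bounded_variation_on F a b \<and> (\<forall>t\<in>{a..<b}. continuous (at_right t) F)"

lemma right_continuous_bv_subinterval:
  assumes "right_continuous_bv F a b" "a \<le> c" "c \<le> d" "d \<le> b"
  shows "right_continuous_bv F c d"
  using assms bounded_variation_on_subinterval[of F a b c d]
  by (auto simp: right_continuous_bv_def)

lemma variation_sums_uminus: "variation_sums (\<lambda>t. - F t) a b = variation_sums F a b"
proof -
  have "\<bar>- F x - - F y\<bar> = \<bar>F x - F y\<bar>" for x y by linarith
  then show ?thesis by (simp add: variation_sums_def)
qed

lemma total_variation_uminus: "total_variation (\<lambda>t. - F t) a b = total_variation F a b"
  by (simp add: total_variation_def variation_sums_uminus)

text \<open>
  This symmetry reduces each statement about the Jordan decomposition to the positive part.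
\<close>

lemma neg_variation_measure_eq:
  "neg_variation_measure F a b = pos_variation_measure (\<lambda>t. - F t) a b"
  unfolding neg_variation_measure_def pos_variation_measure_def total_variation_uminus
  by (simp add: Let_def algebra_simps)

lemma right_continuous_bv_uminus:
  "right_continuous_bv F a b \<Longrightarrow> right_continuous_bv (\<lambda>t. - F t) a b"
  by (auto simp: right_continuous_bv_def bounded_variation_on_def variation_sums_uminus
      intro: continuous_minus)

lemma sets_pos_variation_measure [simp, measurable_cong]:
  "sets (pos_variation_measure F a b) = sets borel"
  "space (pos_variation_measure F a b) = UNIV"
  by (simp_all add: pos_variation_measure_def)

text \<open>
  The distribution function is nondecreasing because \<open>|F(y) - F(x)|\<close> is at most the variation on \<open>[x, y]\<close>,
  and right-continuous because the variation is. Without the latter the interval measure would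
  degenerate, since no measure with these interval masses would exist.
\<close>

lemma emeasure_pos_variation_measure:
  assumes F: "right_continuous_bv F a b" and "a \<le> c" "c \<le> d" "d \<le> b"
  shows "emeasure (pos_variation_measure F a b) {c<..d} =
    ennreal ((total_variation F c d + (F d - F c)) / 2)"
proof -
  define clip where "clip t = max a (min b t)" for t :: real
  define P where "P t = (total_variation F a (clip t) + (F (clip t) - F a)) / 2" for t
  have bv: "bounded_variation_on F x y" if "a \<le> x" "x \<le> y" "y \<le> b" for x y
    using F that bounded_variation_on_subinterval by (auto simp: right_continuous_bv_def)
  have diff: "P y - P x = (total_variation F (clip x) (clip y) + (F (clip y) - F (clip x))) / 2"
    if "x \<le> y" for x y
  proof -
    have "a \<le> clip x" "clip x \<le> clip y" "clip y \<le> b" using that assms by (auto simp: clip_def)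
    then show ?thesis
      using total_variation_add[OF bv, of a "clip y" "clip x"] by (auto simp: P_def field_simps)
  qed
  have inc: "\<bar>F (clip y) - F (clip x)\<bar> \<le> total_variation F (clip x) (clip y)" if "x \<le> y" for x y
    using that assms by (intro increment_le_total_variation bv) (auto simp: clip_def)
  have mono: "P x \<le> P y" if "x \<le> y" for x y
    using diff[OF that] inc[OF that] by auto
  have rc: "continuous (at_right t) P" for t
    unfolding continuous_at_right_iff
  proof (intro allI impI)
    fix e :: real assume "e > 0"
    consider "t < a" | "a \<le> t" "t < b" | "b \<le> t" by linarith
    then show "\<exists>d>0. \<forall>r. t < r \<and> r < t + d \<longrightarrow> \<bar>P r - P t\<bar> < e"
    proof cases
      case 1
      then show ?thesis using \<open>e > 0\<close> assms
        by (intro exI[of _ "a - t"]) (auto simp: P_def clip_def)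
    next
      case 2
      then obtain d where "d > 0" and
        d: "\<And>r. t \<le> r \<Longrightarrow> r < t + d \<Longrightarrow> r \<le> b \<and> total_variation F t r < e"
        using total_variation_right_continuous[OF bv, of t b e] F \<open>e > 0\<close>
        by (auto simp: right_continuous_bv_def)
      have "\<bar>P r - P t\<bar> < e" if "t < r" "r < t + d" for r
        using d[of r] diff[of t r] inc[of t r] mono[of t r] that 2 by (auto simp: clip_def)
      then show ?thesis using \<open>d > 0\<close> by blast
    next
      case 3
      then have "P r = P t" if "t < r" for r using that by (auto simp: P_def clip_def)
      then show ?thesis using \<open>e > 0\<close> by (auto intro!: exI[of _ 1])
    qed
  qed
  have "pos_variation_measure F a b = interval_measure P"
    by (simp add: pos_variation_measure_def P_def[abs_def] clip_def Let_def)
  then show ?thesis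
    using emeasure_interval_measure_Ioc[of c d P, OF _ mono rc] diff[of c d] assms
    by (auto simp: clip_def)
qed

text \<open>
  The two distribution functions differ by a constant on \<open>[c, d]\<close>, so that the measures agree on the
  half-open subintervals, which generate the Borel sets. The left end point carries no atom that
  could distinguish them, because the intervals are open on the left.
\<close>

lemma pos_variation_measure_restrict:
  assumes F: "right_continuous_bv F a b" and "a \<le> c" "c \<le> d" "d \<le> b"
  shows "density (pos_variation_measure F a b) (\<lambda>x. ennreal (indicator {c<..d} x)) =
    density (pos_variation_measure F c d) (\<lambda>x. ennreal (indicator {c<..d} x))"
proof (rule measure_eqI_generator_eq)
  let ?E = "range (\<lambda>(x, y). {x<..y::real})"
  let ?M = "density (pos_variation_measure F a b) (\<lambda>x. ennreal (indicator {c<..d} x))"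
  let ?N = "density (pos_variation_measure F c d) (\<lambda>x. ennreal (indicator {c<..d} x))"
  have em: "emeasure (density M (\<lambda>x. ennreal (indicator {c<..d} x))) X = emeasure M ({c<..d} \<inter> X)"
    if "sets M = sets borel" "X \<in> sets borel" for M and X :: "real set"
  proof -
    have "(\<lambda>x. ennreal (indicator {c<..d} x)) = indicator {c<..d}"
      by (auto split: split_indicator)
    then show ?thesis using that emeasure_restricted[of "{c<..d}" M X] by simp
  qed
  show "Int_stable ?E"
    unfolding Int_stable_def by (auto simp: image_iff)
  show "?E \<subseteq> Pow UNIV" by auto
  show "emeasure ?M X = emeasure ?N X" if "X \<in> ?E" for X
  proof -
    obtain x y where X: "X = {x<..y}" using \<open>X \<in> _\<close> by auto
    have int: "{c<..d} \<inter> X = {max c x<..min d y}" by (auto simp: X)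
    have "emeasure ?M X = emeasure (pos_variation_measure F a b) {max c x<..min d y}"
      using em[of "pos_variation_measure F a b" X] by (simp add: int) (simp add: X)
    also have "\<dots> = emeasure (pos_variation_measure F c d) {max c x<..min d y}"
    proof (cases "max c x \<le> min d y")
      case True
      then show ?thesis
        using emeasure_pos_variation_measure[OF F, of "max c x" "min d y"]
          emeasure_pos_variation_measure[OF right_continuous_bv_subinterval[OF F], of c d "max c x" "min d y"]
          assms by auto
    qed auto
    also have "\<dots> = emeasure ?N X"
      using em[of "pos_variation_measure F c d" X] by (simp add: int) (simp add: X)
    finally show ?thesis .
  qed
  show "sets ?M = sigma_sets UNIV ?E" "sets ?N = sigma_sets UNIV ?E"
    by (simp_all add: borel_sigma_sets_Ioc)
  show "range (\<lambda>i::nat. {- real i<..real i}) \<subseteq> ?E" by auto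
  show "(\<Union>i::nat. {- real i<..real i}) = UNIV"
  proof (intro set_eqI iffI UNIV_I)
    fix x :: real
    obtain n :: nat where "\<bar>x\<bar> < real n" using reals_Archimedean2 by blast
    then show "x \<in> (\<Union>i::nat. {- real i<..real i})" by (intro UN_I[of n]) auto
  qed
  show "emeasure ?M {- real i<..real i} \<noteq> \<infinity>" for i :: nat
  proof -
    have "emeasure ?M {- real i<..real i} = emeasure (pos_variation_measure F a b) ({c<..d} \<inter> {- real i<..real i})"
      by (rule em) auto
    also have "\<dots> \<le> emeasure (pos_variation_measure F a b) {c<..d}"
      by (rule emeasure_mono) auto
    also have "\<dots> < \<infinity>"
      using emeasure_pos_variation_measure[OF assms] by simp
    finally show ?thesis by simp
  qed
qed

lemma set_integral_pos_variation_restrict: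
  fixes f :: "real \<Rightarrow> 'b::euclidean_space"
  assumes F: "right_continuous_bv F a b" and "a \<le> c" "c \<le> d" "d \<le> b"
    and f: "set_borel_measurable borel {c<..d} f"
  shows "set_lebesgue_integral (pos_variation_measure F a b) {c<..d} f =
    set_lebesgue_integral (pos_variation_measure F c d) {c<..d} f"
proof -
  have eq: "set_lebesgue_integral M {c<..d} f =
      integral\<^sup>L (density M (\<lambda>x. ennreal (indicator {c<..d} x))) (\<lambda>x. indicator {c<..d} x *\<^sub>R f x)"
    if [simp, measurable_cong]: "sets M = sets borel" for M :: "real measure"
  proof -
    have "(\<lambda>x. indicator {c<..d} x *\<^sub>R f x) \<in> borel_measurable M"
      using f that measurable_cong_sets[OF that refl] by (auto simp: set_borel_measurable_def)
    then show ?thesis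
      by (subst integral_density) (auto simp: set_lebesgue_integral_def simp flip: scaleR_scaleR intro!: Bochner_Integration.integral_cong split: split_indicator)
  qed
  show ?thesis
    using eq[of "pos_variation_measure F a b"] eq[of "pos_variation_measure F c d"]
      pos_variation_measure_restrict[OF assms(1-4)] by simp
qed

lemma set_integrable_pos_variation:
  fixes f :: "real \<Rightarrow> 'b::euclidean_space"
  assumes F: "right_continuous_bv F a b" and "a \<le> b"
    and f: "set_borel_measurable borel {a<..b} f" and bd: "\<And>t. t \<in> {a<..b} \<Longrightarrow> norm (f t) \<le> C"
  shows "set_integrable (pos_variation_measure F a b) {a<..b} f"
proof -
  have "integrable (pos_variation_measure F a b) (\<lambda>x. indicator {a<..b} x *\<^sub>R C)"
    using emeasure_pos_variation_measure[OF F, of a b] \<open>a \<le> b\<close> by (intro integrable_indicator) auto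
  moreover have "(\<lambda>x. indicator {a<..b} x *\<^sub>R f x) \<in> borel_measurable (pos_variation_measure F a b)"
    using f measurable_cong_sets[OF sets_pos_variation_measure(1) refl] by (auto simp: set_borel_measurable_def)
  ultimately show ?thesis
    unfolding set_integrable_def
    by (rule Bochner_Integration.integrable_bound)
      (intro AE_I2, use bd in \<open>fastforce simp: indicator_def\<close>)
qed

lemma LS_integrable_bounded:
  fixes f :: "real \<Rightarrow> 'b::euclidean_space"
  assumes F: "right_continuous_bv F a b" and "a \<le> b"
    and f: "set_borel_measurable borel {a<..b} f" and bd: "\<And>t. t \<in> {a<..b} \<Longrightarrow> norm (f t) \<le> C"
  shows "LS_integrable f F a b"
  unfolding LS_integrable_def neg_variation_measure_eq
  using set_integrable_pos_variation[OF F assms(2-4)]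
    set_integrable_pos_variation[OF right_continuous_bv_uminus[OF F] assms(2-4)] F
  by (auto simp: right_continuous_bv_def)

lemma LS_integral_split:
  fixes f :: "real \<Rightarrow> 'b::euclidean_space"
  assumes F: "right_continuous_bv F a c" and "a \<le> b" "b \<le> c"
    and f: "set_borel_measurable borel {a<..c} f" and bd: "\<And>t. t \<in> {a<..c} \<Longrightarrow> norm (f t) \<le> C"
  shows "LS_integral f F a c = LS_integral f F a b + LS_integral f F b c"
proof -
  have U: "{a<..c} = {a<..b} \<union> {b<..c}" using assms by auto
  have fm: "set_borel_measurable borel {a<..b} f" "set_borel_measurable borel {b<..c} f"
    using assms by (auto intro: set_borel_measurable_subset[OF f])
  have *: "set_lebesgue_integral (pos_variation_measure H a c) {a<..c} f =
     set_lebesgue_integral (pos_variation_measure H a b) {a<..b} f +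
     set_lebesgue_integral (pos_variation_measure H b c) {b<..c} f"
    if H: "right_continuous_bv H a c" for H
  proof -
    have int: "set_integrable (pos_variation_measure H a c) {a<..c} f"
      using set_integrable_pos_variation[OF H _ f bd] assms by simp
    have "set_lebesgue_integral (pos_variation_measure H a c) {a<..c} f =
       set_lebesgue_integral (pos_variation_measure H a c) {a<..b} f +
       set_lebesgue_integral (pos_variation_measure H a c) {b<..c} f"
      unfolding U by (rule set_integral_Un) (auto intro!: set_integrable_subset[OF int] simp: U)
    then show ?thesis
      using set_integral_pos_variation_restrict[OF H _ _ _ fm(1)]
        set_integral_pos_variation_restrict[OF H _ _ _ fm(2)] assms by simp
  qed
  show ?thesis
    unfolding LS_integral_def neg_variation_measure_eq
    using *[OF F] *[OF right_continuous_bv_uminus[OF F]] by simp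
qed

text \<open>
  The basic estimate for Stieltjes integrals: the integral of the constant \<open>c\<close> is \<open>(F(b) - F(a)) c\<close>, and the
  masses of the two Jordan parts add up to the total variation.
\<close>

lemma LS_integral_approx:
  fixes f :: "real \<Rightarrow> 'b::euclidean_space"
  assumes F: "right_continuous_bv F a b" and "a \<le> b"
    and f: "set_borel_measurable borel {a<..b} f"
    and e: "\<And>t. t \<in> {a<..b} \<Longrightarrow> norm (f t - c) \<le> e"
  shows "norm (LS_integral f F a b - (F b - F a) *\<^sub>R c) \<le> e * total_variation F a b"
proof -
  let ?I = "{a<..b}"
  have bd: "norm (f t) \<le> norm c + e" if "t \<in> ?I" for t
    using e[OF that] norm_triangle_sub[of "f t" c] by linarith
  have *: "norm (set_lebesgue_integral (pos_variation_measure H a b) ?I f -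
       ((total_variation F a b + (H b - H a)) / 2) *\<^sub>R c)
      \<le> e * ((total_variation F a b + (H b - H a)) / 2)"
    if H: "right_continuous_bv H a b" and V: "total_variation H a b = total_variation F a b" for H
  proof -
    let ?M = "pos_variation_measure H a b"
    let ?m = "(total_variation F a b + (H b - H a)) / 2"
    have m0: "0 \<le> ?m"
      using increment_le_total_variation[of H a b] H \<open>a \<le> b\<close> V by (auto simp: right_continuous_bv_def)
    have em: "emeasure ?M ?I = ennreal ?m"
      using emeasure_pos_variation_measure[OF H, of a b] \<open>a \<le> b\<close> V by simp
    then have me: "measure ?M ?I = ?m" using m0 by (simp add: measure_def)
    have intf: "set_integrable ?M ?I f"
      using set_integrable_pos_variation[OF H \<open>a \<le> b\<close> f bd] by simp
    have intc: "set_integrable ?M ?I (\<lambda>_. c)"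
      unfolding set_integrable_def using em by (intro integrable_scaleR_left integrable_real_indicator) auto
    have inte: "set_integrable ?M ?I (\<lambda>_. e)"
      unfolding set_integrable_def using em by (intro integrable_scaleR_left integrable_real_indicator) auto
    have "set_lebesgue_integral ?M ?I f - ?m *\<^sub>R c = set_lebesgue_integral ?M ?I (\<lambda>t. f t - c)"
      using set_integral_diff(2)[OF intf intc] me em by (simp add: set_lebesgue_integral_def)
    also have "norm \<dots> \<le> set_lebesgue_integral ?M ?I (\<lambda>_. e)"
      unfolding set_lebesgue_integral_def
    proof (rule Bochner_Integration.integral_norm_bound_integral)
      show "integrable ?M (\<lambda>t. indicator ?I t *\<^sub>R (f t - c))"
        using set_integral_diff(1)[OF intf intc] by (simp add: set_integrable_def)
    qed (use e inte in \<open>auto simp: set_integrable_def split: split_indicator\<close>)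
    also have "\<dots> = e * ?m" using me em by (simp add: set_lebesgue_integral_def)
    finally show ?thesis .
  qed
  let ?p = "set_lebesgue_integral (pos_variation_measure F a b) ?I f"
  let ?q = "set_lebesgue_integral (neg_variation_measure F a b) ?I f"
  let ?V = "total_variation F a b" and ?D = "F b - F a"
  have "LS_integral f F a b - ?D *\<^sub>R c = (?p - ((?V + ?D)/2) *\<^sub>R c) - (?q - ((?V + (- F b - - F a))/2) *\<^sub>R c)"
  proof -
    have *: "?D = (?V + ?D)/2 - (?V + (- F b - - F a))/2" by (simp add: field_simps)
    have "?D *\<^sub>R c = ((?V + ?D)/2) *\<^sub>R c - ((?V + (- F b - - F a))/2) *\<^sub>R c"
      by (subst *) (rule scaleR_diff_left)
    then show ?thesis unfolding LS_integral_def by simp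
  qed
  also have "norm \<dots> \<le> e * ((?V + ?D)/2) + e * ((?V + (- F b - - F a))/2)"
    unfolding neg_variation_measure_eq
    by (rule order_trans[OF norm_triangle_ineq4
          add_mono[OF *[OF F refl] *[OF right_continuous_bv_uminus[OF F] total_variation_uminus]]])
  also have "\<dots> = e * ?V" by (simp add: field_simps)
  finally show ?thesis .
qed

section \<open>Integral equations from first-order expansions\<close>

text \<open>
  Summing the increments over equidistant partitions yields \<open>|\<psi>(b) - \<psi>(a)| \<le> \<epsilon> (W(b) - W(a))\<close> for every \<open>\<epsilon>\<close>:
  a Stieltjes form of the fact that a vanishing derivative forces a function to be constant.
\<close>

lemma eq_if_increments_dominated:
  fixes \<psi> :: "real \<Rightarrow> 'a::real_normed_vector"
  assumes "a \<le> b"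
    and dom: "\<And>e. e > 0 \<Longrightarrow> \<exists>d>0. \<forall>s t. a \<le> s \<and> s \<le> t \<and> t \<le> b \<and> t - s < d \<longrightarrow>
      norm (\<psi> t - \<psi> s) \<le> e * (W t - W s)"
  shows "\<psi> b = \<psi> a"
proof -
  have main: "norm (\<psi> b - \<psi> a) \<le> e * (W b - W a)" if "e > 0" for e
  proof -
    obtain d where "d > 0" and d: "\<And>s t. a \<le> s \<Longrightarrow> s \<le> t \<Longrightarrow> t \<le> b \<Longrightarrow> t - s < d \<Longrightarrow>
        norm (\<psi> t - \<psi> s) \<le> e * (W t - W s)"
      using dom[OF \<open>e > 0\<close>] by blast
    obtain n :: nat where n: "(b - a) / d < real n" using reals_Archimedean2 by blast
    then have "n > 0" using \<open>a \<le> b\<close> \<open>d > 0\<close> by (metis diff_ge_0_iff_ge divide_nonneg_pos gr0I less_le_not_le of_nat_0)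
    define r where "r k = a + real k * ((b - a) / real n)" for k
    have step: "r (Suc k) = r k + (b - a) / real n" for k
      unfolding r_def of_nat_Suc distrib_right by simp
    have rn: "r n = b" "r 0 = a" using \<open>n > 0\<close> by (auto simp: r_def)
    have small: "(b - a) / real n < d" "0 \<le> (b - a) / real n"
      using n \<open>n > 0\<close> \<open>d > 0\<close> \<open>a \<le> b\<close> by (auto simp: field_simps)
    have mono: "\<forall>k<n. r k \<le> r (Suc k)" using step small by simp
    have "norm (\<psi> b - \<psi> a) = norm (\<Sum>k<n. \<psi> (r (Suc k)) - \<psi> (r k))"
      by (subst sum_lessThan_telescope) (simp add: rn)
    also have "\<dots> \<le> (\<Sum>k<n. norm (\<psi> (r (Suc k)) - \<psi> (r k)))" by (rule norm_sum)
    also have "\<dots> \<le> (\<Sum>k<n. e * (W (r (Suc k)) - W (r k)))"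
    proof (intro sum_mono d)
      fix k assume "k \<in> {..<n}"
      then show "a \<le> r k" "r (Suc k) \<le> b"
        using partition_mono[OF mono, of 0 k] partition_mono[OF mono, of "Suc k" n] rn by auto
    qed (use step small in auto)
    also have "\<dots> = e * (W b - W a)"
      unfolding sum_distrib_left[symmetric] by (subst sum_lessThan_telescope) (simp add: rn)
    finally show ?thesis .
  qed
  have "norm (\<psi> b - \<psi> a) \<le> 0"
  proof (rule field_le_epsilon)
    fix e :: real assume "e > 0"
    have "norm (\<psi> b - \<psi> a) \<le> (e / (\<bar>W b - W a\<bar> + 1)) * (W b - W a)"
      using \<open>e > 0\<close> by (intro main) auto
    also have "\<dots> \<le> (e / (\<bar>W b - W a\<bar> + 1)) * (\<bar>W b - W a\<bar> + 1)"
      using \<open>e > 0\<close> by (intro mult_left_mono) auto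
    also have "\<dots> = e" by (simp add: add_nonneg_eq_0_iff)
    finally show "norm (\<psi> b - \<psi> a) \<le> 0 + e" by simp
  qed
  then show ?thesis by simp
qed

lemma continuous_on_interval_modulus:
  fixes f :: "real \<Rightarrow> 'a::metric_space"
  assumes "continuous_on {c..d} f" "e > 0"
  shows "\<exists>\<delta>>0. \<forall>s t. c \<le> s \<and> s \<le> t \<and> t \<le> d \<and> t - s < \<delta> \<longrightarrow> dist (f t) (f s) \<le> e"
proof -
  obtain \<delta> where "\<delta> > 0" "\<And>x x'. x \<in> {c..d} \<Longrightarrow> x' \<in> {c..d} \<Longrightarrow> dist x' x < \<delta> \<Longrightarrow> dist (f x') (f x) < e"
    using compact_uniformly_continuous[OF assms(1)] \<open>e > 0\<close>
    unfolding uniformly_continuous_on_def by (metis compact_Icc)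
  then have "dist (f t) (f s) \<le> e" if "c \<le> s" "s \<le> t" "t \<le> d" "t - s < \<delta>" for s t
    using that by (intro less_imp_le) (auto simp: dist_real_def)
  then show ?thesis using \<open>\<delta> > 0\<close> by blast
qed

text \<open>
  Uniform continuity is needed for finitely many functions at once; this takes the smallest of their moduli.
\<close>

lemma ex_common_radius:
  fixes Q :: "'i \<Rightarrow> real \<Rightarrow> bool"
  assumes "finite I" and ex: "\<And>i. i \<in> I \<Longrightarrow> \<exists>\<delta>>0. Q i \<delta>"
    and mono: "\<And>i \<delta> \<delta>'. Q i \<delta> \<Longrightarrow> \<delta>' \<le> \<delta> \<Longrightarrow> Q i \<delta>'"
  shows "\<exists>\<delta>>0. \<forall>i\<in>I. Q i \<delta>"
  using assms(1) ex
proof (induction I)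
  case empty then show ?case by (intro exI[of _ 1]) auto
next
  case (insert i I)
  then obtain d1 d2 where "d1 > 0" "Q i d1" "d2 > 0" "\<forall>i\<in>I. Q i d2" by (meson insertCI)
  then show ?case using mono by (intro exI[of _ "min d1 d2"]) (auto intro: mono)
qed

text \<open>
  If \<open>y\<close> has the first-order expansion \<open>dy = k\<^sub>0 dt + \<Sum>\<^sub>j (\<Sum>\<^sub>i h\<^sub>i\<^sub>j k\<^sub>i) dU\<^sub>j\<close> and \<open>\<beta>\<^sub>i\<close> is the indefinite integral of
  \<open>\<Sum>\<^sub>j h\<^sub>i\<^sub>j dU\<^sub>j\<close>, then over a short interval each of the Stieltjes integrals involved may be replaced by its
  integrand at the left end point times an increment. The replacement errors are bounded by small
  multiples of the variations of the \<open>U\<^sub>j\<close>, and what remains is the expansion of \<open>y\<close>. On \<open>[0, c]\<close> the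
  coefficients \<open>h\<^sub>i\<^sub>j\<close> are only measurable and bounded, since they may jump there.
\<close>

lemma LS_equation_from_expansion:
  fixes U :: "'j::finite \<Rightarrow> real \<Rightarrow> real" and h :: "'i::finite \<Rightarrow> 'j \<Rightarrow> real \<Rightarrow> real"
    and \<beta> :: "'i \<Rightarrow> real \<Rightarrow> real" and y k\<^sub>0 :: "real \<Rightarrow> 'b::euclidean_space"
    and k :: "'i \<Rightarrow> real \<Rightarrow> 'b"
  assumes cd: "0 \<le> c" "c \<le> d"
    and U: "\<And>j. right_continuous_bv (U j) 0 d"
    and hm: "\<And>i j. set_borel_measurable borel {0<..d} (h i j)"
    and hb: "\<And>i j t. t \<in> {0<..d} \<Longrightarrow> \<bar>h i j t\<bar> \<le> M"
    and hc: "\<And>i j. continuous_on {c..d} (h i j)"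
    and k0c: "continuous_on {c..d} k\<^sub>0"
    and kc: "\<And>i. continuous_on {c..d} (k i)"
    and \<beta>: "\<And>i t. \<beta> i t = (\<Sum>j\<in>UNIV. LS_integral (h i j) (U j) 0 t)"
    and expansion: "\<And>e. e > 0 \<Longrightarrow> \<exists>\<delta>>0. \<forall>s t. c \<le> s \<and> s \<le> t \<and> t \<le> d \<and> t - s < \<delta> \<longrightarrow>
      norm (y t - y s - (t - s) *\<^sub>R k\<^sub>0 s - (\<Sum>j\<in>UNIV. (U j t - U j s) *\<^sub>R (\<Sum>i\<in>UNIV. h i j s *\<^sub>R k i s)))
      \<le> e * (t - s + (\<Sum>j\<in>UNIV. \<bar>U j t - U j s\<bar>))"
  shows "set_integrable lborel {c..d} k\<^sub>0"
    and "LS_integrable (k i) (\<beta> i) c d"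
    and "y d - y c = set_lebesgue_integral lborel {c..d} k\<^sub>0 +
      (\<Sum>i\<in>UNIV. LS_integral (k i) (\<beta> i) c d)"
proof -
  show k0int: "set_integrable lborel {c..d} k\<^sub>0"
    by (rule borel_integrable_atLeastAtMost'[OF k0c])
  have rU: "right_continuous_bv (U j) s t" if "0 \<le> s" "s \<le> t" "t \<le> d" for s t j
    using right_continuous_bv_subinterval[OF U] that by blast
  have bU: "bounded_variation_on (U j) s t" if "0 \<le> s" "s \<le> t" "t \<le> d" for s t j
    using rU[OF that] by (auto simp: right_continuous_bv_def)
  \<comment> \<open>For \<open>d = 0\<close> the bound \<open>M\<close> is void and may be negative.\<close>
  define M' where "M' = max M 0"
  have M': "M' \<ge> 0" "\<And>i j t. t \<in> {0<..d} \<Longrightarrow> \<bar>h i j t\<bar> \<le> M'"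
    using hb by (auto simp: M'_def le_max_iff_disj)
  have hm': "set_borel_measurable borel {s<..t} (h i j)" if "0 \<le> s" "t \<le> d" for s t i j
    using that by (intro set_borel_measurable_subset[OF hm]) auto
  define S where "S s t = (\<Sum>j\<in>UNIV. total_variation (U j) s t)" for s t
  have S_add: "S 0 t = S 0 s + S s t" if "0 \<le> s" "s \<le> t" "t \<le> d" for s t
    unfolding S_def sum.distrib[symmetric]
    using that by (intro sum.cong refl total_variation_add bU) auto
  have S0: "0 \<le> S s t" if "0 \<le> s" "s \<le> t" "t \<le> d" for s t
    unfolding S_def using that by (intro sum_nonneg total_variation_nonneg bU)
  have U_le: "(\<Sum>j\<in>UNIV. \<bar>U j t - U j s\<bar>) \<le> S s t" if "0 \<le> s" "s \<le> t" "t \<le> d" for s t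
    unfolding S_def using that by (intro sum_mono increment_le_total_variation bU)
  have \<beta>_inc: "\<beta> i t - \<beta> i s = (\<Sum>j\<in>UNIV. LS_integral (h i j) (U j) s t)"
    if "0 \<le> s" "s \<le> t" "t \<le> d" for i s t
  proof -
    have "LS_integral (h i j) (U j) 0 t = LS_integral (h i j) (U j) 0 s + LS_integral (h i j) (U j) s t" for j
      using that M' by (intro LS_integral_split[where C=M'] rU hm') auto
    then show ?thesis unfolding \<beta> by (simp add: sum.distrib)
  qed
  have \<beta>_le: "\<bar>\<beta> i t - \<beta> i s\<bar> \<le> M' * S s t" if "0 \<le> s" "s \<le> t" "t \<le> d" for i s t
  proof -
    have "\<bar>LS_integral (h i j) (U j) s t\<bar> \<le> M' * total_variation (U j) s t" for j
      using LS_integral_approx[OF rU[OF that], of "h i j" 0 M'] that M' hm' by auto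
    then have "\<bar>\<beta> i t - \<beta> i s\<bar> \<le> (\<Sum>j\<in>UNIV. M' * total_variation (U j) s t)"
      unfolding \<beta>_inc[OF that] by (intro order_trans[OF sum_abs] sum_mono) auto
    then show ?thesis by (simp add: S_def sum_distrib_left)
  qed
  have \<beta>V: "bounded_variation_on (\<beta> i) s t" "total_variation (\<beta> i) s t \<le> M' * S s t"
    if "0 \<le> s" "s \<le> t" "t \<le> d" for i s t
  proof -
    have *: "\<bar>\<beta> i r' - \<beta> i r\<bar> \<le> M' * S 0 r' - M' * S 0 r" if "s \<le> r" "r \<le> r'" "r' \<le> t" for r r'
      using \<beta>_le[of r r' i] S_add[of r r'] that \<open>0 \<le> s\<close> \<open>t \<le> d\<close> by (auto simp: algebra_simps)
    note bounded_variation_on_dominated[OF \<open>s \<le> t\<close>, of "\<beta> i" "\<lambda>r. M' * S 0 r", OF *]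
    then show "bounded_variation_on (\<beta> i) s t" "total_variation (\<beta> i) s t \<le> M' * S s t"
      using S_add[OF that] by (auto simp: algebra_simps)
  qed
  have S_small: "\<exists>\<delta>>0. \<forall>r. t \<le> r \<and> r < t + \<delta> \<longrightarrow> r \<le> d \<and> S t r < e" if "0 \<le> t" "t < d" "e > 0" for t e
  proof -
    define m where "m = real CARD('j)"
    have "m > 0" by (simp add: m_def)
    have "\<exists>\<delta>>0. \<forall>j\<in>UNIV. \<forall>r. t \<le> r \<and> r < t + \<delta> \<longrightarrow> r \<le> d \<and> total_variation (U j) t r < e / m"
    proof (rule ex_common_radius)
      show "\<exists>\<delta>>0. \<forall>r. t \<le> r \<and> r < t + \<delta> \<longrightarrow> r \<le> d \<and> total_variation (U j) t r < e / m" for j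
        using that \<open>m > 0\<close> rU[of t d j]
        by (intro total_variation_right_continuous) (auto simp: right_continuous_bv_def)
    qed auto
    then obtain \<delta> where \<delta>: "\<delta> > 0" "\<And>j r. t \<le> r \<Longrightarrow> r < t + \<delta> \<Longrightarrow> r \<le> d \<and> total_variation (U j) t r < e / m"
      by blast
    have "S t r < e" if "t \<le> r" "r < t + \<delta>" for r
    proof -
      have "S t r < (\<Sum>j\<in>(UNIV::'j set). e / m)"
        unfolding S_def using \<delta>(2)[OF that] by (intro sum_strict_mono) auto
      also have "\<dots> = e" using \<open>m > 0\<close> by (simp add: m_def)
      finally show ?thesis .
    qed
    then show ?thesis using \<delta> by blast
  qed
  have r\<beta>: "right_continuous_bv (\<beta> i) c d" for i
    unfolding right_continuous_bv_def
  proof (intro conjI ballI)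
    fix t assume t: "t \<in> {c..<d}"
    show "continuous (at_right t) (\<beta> i)"
      unfolding continuous_at_right_iff
    proof (intro allI impI)
      fix e :: real assume "e > 0"
      then obtain \<delta> where "\<delta> > 0" and \<delta>: "\<And>r. t \<le> r \<Longrightarrow> r < t + \<delta> \<Longrightarrow> r \<le> d \<and> S t r < e / (M' + 1)"
        using S_small[of t "e / (M' + 1)"] t cd M' by auto
      have "\<bar>\<beta> i r - \<beta> i t\<bar> < e" if "t < r" "r < t + \<delta>" for r
      proof -
        have r: "r \<le> d" "S t r < e / (M' + 1)" using \<delta>[of r] that by auto
        have "\<bar>\<beta> i r - \<beta> i t\<bar> \<le> M' * S t r" using \<beta>_le[of t r] r t cd that by auto
        also have "\<dots> \<le> (M' + 1) * S t r"
          using S0[of t r] r t cd that by (intro mult_right_mono) auto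
        also have "\<dots> < e" using r M' by (simp add: field_simps)
        finally show ?thesis .
      qed
      then show "\<exists>\<delta>>0. \<forall>r. t < r \<and> r < t + \<delta> \<longrightarrow> \<bar>\<beta> i r - \<beta> i t\<bar> < e" using \<open>\<delta> > 0\<close> by blast
    qed
  qed (use \<beta>V cd in auto)
  have "\<exists>C. \<forall>t\<in>{c..d}. norm (k i t) \<le> C" for i
    using compact_continuous_image[OF kc compact_Icc, THEN compact_imp_bounded]
    unfolding bounded_iff by auto
  then obtain C where C: "\<And>i t. t \<in> {c..d} \<Longrightarrow> norm (k i t) \<le> C i" by metis
  have km: "set_borel_measurable borel {s<..t} (k i)" if "c \<le> s" "t \<le> d" for s t i
    unfolding set_borel_measurable_def
    using that by (intro borel_measurable_continuous_on_indicator continuous_on_subset[OF kc]) auto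
  show "LS_integrable (k i) (\<beta> i) c d" for i
    using C cd by (intro LS_integrable_bounded[OF r\<beta>, where C="C i"] km) auto

  define K where "K = (\<Sum>i\<in>UNIV. C i)"
  define \<psi> where "\<psi> t = y t - integral {c..t} k\<^sub>0 - (\<Sum>i\<in>UNIV. LS_integral (k i) (\<beta> i) c t)" for t
  \<comment> \<open>The weights collect the four error terms below: \<open>2\<close> from the expansion and the integral of \<open>k\<^sub>0\<close>, \<open>1\<close> from the
    expansion, \<open>M'\<close> for each \<open>\<beta>\<^sub>i\<close>, and \<open>K\<close> from the freezing of the coefficients \<open>h\<^sub>i\<^sub>j\<close>.\<close>
  define W where "W t = 2 * t + (1 + real CARD('i) * M' + K) * S 0 t" for t
  have "\<psi> d = \<psi> c"
  proof (rule eq_if_increments_dominated[OF cd(2)])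
    fix e :: real assume "e > 0"
    let ?Q = "\<lambda>f (\<delta>::real). \<forall>s t. c \<le> s \<and> s \<le> t \<and> t \<le> d \<and> t - s < \<delta> \<longrightarrow> dist (f t) (f s) \<le> e"
    obtain \<delta>1 where \<delta>1: "\<delta>1 > 0" "\<And>s t. c \<le> s \<Longrightarrow> s \<le> t \<Longrightarrow> t \<le> d \<Longrightarrow> t - s < \<delta>1 \<Longrightarrow>
      norm (y t - y s - (t - s) *\<^sub>R k\<^sub>0 s - (\<Sum>j\<in>UNIV. (U j t - U j s) *\<^sub>R (\<Sum>i\<in>UNIV. h i j s *\<^sub>R k i s)))
      \<le> e * (t - s + (\<Sum>j\<in>UNIV. \<bar>U j t - U j s\<bar>))"
      using expansion[OF \<open>e > 0\<close>] by blast
    obtain \<delta>2 where \<delta>2: "\<delta>2 > 0" "?Q k\<^sub>0 \<delta>2"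
      using continuous_on_interval_modulus[OF k0c \<open>e > 0\<close>] by blast
    have "\<exists>\<delta>>0. \<forall>i\<in>UNIV. ?Q (k i) \<delta>"
    proof (rule ex_common_radius)
      show "\<exists>\<delta>>0. ?Q (k i) \<delta>" for i by (rule continuous_on_interval_modulus[OF kc \<open>e > 0\<close>])
      show "?Q (k i) \<delta>'" if "?Q (k i) \<delta>" "\<delta>' \<le> \<delta>" for i \<delta> \<delta>'
        using that less_le_trans by metis
    qed auto
    then obtain \<delta>3 where \<delta>3: "\<delta>3 > 0" "\<And>i. ?Q (k i) \<delta>3" by blast
    have "\<exists>\<delta>>0. \<forall>ij\<in>UNIV. ?Q (h (fst ij) (snd ij)) \<delta>"
    proof (rule ex_common_radius)
      show "\<exists>\<delta>>0. ?Q (h (fst ij) (snd ij)) \<delta>" for ij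
        by (rule continuous_on_interval_modulus[OF hc \<open>e > 0\<close>])
      show "?Q (h (fst ij) (snd ij)) \<delta>'" if "?Q (h (fst ij) (snd ij)) \<delta>" "\<delta>' \<le> \<delta>" for ij \<delta> \<delta>'
        using that less_le_trans by metis
    qed auto
    then obtain \<delta>4 where \<delta>4: "\<delta>4 > 0" "\<And>i j. ?Q (h i j) \<delta>4"
      by (metis UNIV_I fst_conv snd_conv)
    define \<delta> where "\<delta> = min (min \<delta>1 \<delta>2) (min \<delta>3 \<delta>4)"
    have "norm (\<psi> t - \<psi> s) \<le> e * (W t - W s)" if st: "c \<le> s" "s \<le> t" "t \<le> d" "t - s < \<delta>" for s t
    proof -
      have s0: "0 \<le> s" using st cd by auto
      have near: "norm (k\<^sub>0 r - k\<^sub>0 s) \<le> e" "norm (k i r - k i s) \<le> e" "norm (h i j r - h i j s) \<le> e"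
        if "s \<le> r" "r \<le> t" for r i j
        using that st \<delta>2 \<delta>3(2)[of i] \<delta>4(2)[of i j] by (auto simp: dist_norm \<delta>_def)
      \<comment> \<open>Four sources of error: the expansion of \<open>y\<close>, and freezing the integrand at \<open>s\<close> in the integrals of \<open>k\<^sub>0\<close>
        against \<open>dt\<close>, of \<open>k\<^sub>i\<close> against \<open>d\<beta>\<^sub>i\<close> and of \<open>h\<^sub>i\<^sub>j\<close> against \<open>dU\<^sub>j\<close>.\<close>
      define E1 where "E1 = y t - y s - (t - s) *\<^sub>R k\<^sub>0 s - (\<Sum>j\<in>UNIV. (U j t - U j s) *\<^sub>R (\<Sum>i\<in>UNIV. h i j s *\<^sub>R k i s))"
      define E2 where "E2 = integral {s..t} k\<^sub>0 - (t - s) *\<^sub>R k\<^sub>0 s"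
      define E3 where "E3 i = LS_integral (k i) (\<beta> i) s t - (\<beta> i t - \<beta> i s) *\<^sub>R k i s" for i
      define E4 where "E4 i j = LS_integral (h i j) (U j) s t - (U j t - U j s) *\<^sub>R h i j s" for i j
      have e1: "norm E1 \<le> e * ((t - s) + S s t)"
      proof -
        have "norm E1 \<le> e * (t - s + (\<Sum>j\<in>UNIV. \<bar>U j t - U j s\<bar>))"
          unfolding E1_def using st by (intro \<delta>1) (auto simp: \<delta>_def)
        also have "\<dots> \<le> e * ((t - s) + S s t)"
          using U_le[OF s0 st(2,3)] \<open>e > 0\<close> by (intro mult_left_mono) auto
        finally show ?thesis .
      qed
      have e2: "norm E2 \<le> e * (t - s)"
      proof -
        have c1: "continuous_on {s..t} k\<^sub>0" using st by (intro continuous_on_subset[OF k0c]) auto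
        have "E2 = integral {s..t} (\<lambda>r. k\<^sub>0 r - k\<^sub>0 s)"
          unfolding E2_def using st
          by (subst Henstock_Kurzweil_Integration.integral_diff) (auto intro: integrable_continuous_real c1)
        also have "norm \<dots> \<le> e * (t - s)"
          using st near(1) by (intro integral_bound) (auto intro!: continuous_intros c1)
        finally show ?thesis .
      qed
      have e3: "norm (E3 i) \<le> e * (M' * S s t)" for i
      proof -
        have "norm (E3 i) \<le> e * total_variation (\<beta> i) s t"
          unfolding E3_def using st near(2)
          by (intro LS_integral_approx right_continuous_bv_subinterval[OF r\<beta>] km) auto
        also have "\<dots> \<le> e * (M' * S s t)"
          using \<beta>V(2)[OF s0 st(2,3)] \<open>e > 0\<close> by (intro mult_left_mono) auto
        finally show ?thesis .
      qed
      have e4: "norm (E4 i j) \<le> e * total_variation (U j) s t" for i j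
        unfolding E4_def using st s0 near(3) by (intro LS_integral_approx rU hm') auto
      have e4': "norm (\<Sum>j\<in>UNIV. E4 i j *\<^sub>R k i s) \<le> C i * (e * S s t)" for i
      proof -
        have "norm (\<Sum>j\<in>UNIV. E4 i j *\<^sub>R k i s) \<le> (\<Sum>j\<in>UNIV. (e * total_variation (U j) s t) * C i)"
        proof (intro order_trans[OF norm_sum] sum_mono)
          fix j
          have "0 \<le> e * total_variation (U j) s t"
            using \<open>e > 0\<close> total_variation_nonneg[OF bU] s0 st by auto
          then show "norm (E4 i j *\<^sub>R k i s) \<le> (e * total_variation (U j) s t) * C i"
            unfolding norm_scaleR using e4[of i j] C[of s i] st by (intro mult_mono) auto
        qed
        also have "\<dots> = C i * (e * S s t)"
          by (simp add: S_def sum_distrib_left sum_distrib_right mult_ac)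
        finally show ?thesis .
      qed
      have split_k0: "integral {c..t} k\<^sub>0 = integral {c..s} k\<^sub>0 + integral {s..t} k\<^sub>0"
        using st by (intro Henstock_Kurzweil_Integration.integral_combine[symmetric] integrable_continuous_real continuous_on_subset[OF k0c]) auto
      have split_k: "LS_integral (k i) (\<beta> i) c t = LS_integral (k i) (\<beta> i) c s + LS_integral (k i) (\<beta> i) s t" for i
        using st C by (intro LS_integral_split[where C="C i"] right_continuous_bv_subinterval[OF r\<beta>] km) auto
      have b: "\<beta> i t - \<beta> i s = (\<Sum>j\<in>UNIV. E4 i j + (U j t - U j s) * h i j s)" for i
        unfolding \<beta>_inc[OF s0 st(2,3)] E4_def by simp
      have swap: "(\<Sum>j\<in>UNIV. (U j t - U j s) *\<^sub>R (\<Sum>i\<in>UNIV. h i j s *\<^sub>R k i s)) =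
         (\<Sum>i\<in>UNIV. (\<Sum>j\<in>UNIV. (U j t - U j s) * h i j s) *\<^sub>R k i s)"
        unfolding scaleR_sum_right scaleR_sum_left by (subst sum.swap) simp
      have "(\<Sum>i\<in>UNIV. LS_integral (k i) (\<beta> i) s t) =
          (\<Sum>i\<in>UNIV. E3 i + (\<Sum>j\<in>UNIV. E4 i j *\<^sub>R k i s) + (\<Sum>j\<in>UNIV. (U j t - U j s) * h i j s) *\<^sub>R k i s)"
        unfolding E3_def b by (intro sum.cong refl) (simp add: sum.distrib scaleR_add_left scaleR_sum_left)
      then have "\<psi> t - \<psi> s = E1 - E2 - (\<Sum>i\<in>UNIV. E3 i) - (\<Sum>i\<in>UNIV. \<Sum>j\<in>UNIV. E4 i j *\<^sub>R k i s)"
        unfolding \<psi>_def E1_def E2_def split_k0 split_k swap by (simp add: sum.distrib algebra_simps)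
      also have "norm \<dots> \<le> e * ((t - s) + S s t) + e * (t - s) + (\<Sum>i\<in>(UNIV::'i set). e * (M' * S s t)) + (\<Sum>i\<in>UNIV. C i * (e * S s t))"
        using sum_norm_le[of UNIV E3 "\<lambda>i. e * (M' * S s t)", OF e3]
          sum_norm_le[of UNIV "\<lambda>i. \<Sum>j\<in>UNIV. E4 i j *\<^sub>R k i s", OF e4']
        by (intro order_trans[OF norm_triangle_ineq4] add_mono e1 e2)
      also have "\<dots> = e * (W t - W s)"
        unfolding W_def S_add[OF s0 st(2,3)] sum_distrib_right[symmetric] K_def[symmetric]
        by (simp add: algebra_simps)
      finally show ?thesis .
    qed
    moreover have "\<delta> > 0" using \<delta>1 \<delta>2 \<delta>3 \<delta>4 by (auto simp: \<delta>_def)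
    ultimately show "\<exists>\<delta>>0. \<forall>s t. c \<le> s \<and> s \<le> t \<and> t \<le> d \<and> t - s < \<delta> \<longrightarrow> norm (\<psi> t - \<psi> s) \<le> e * (W t - W s)"
      by blast
  qed
  moreover have "LS_integral (k i) (\<beta> i) c c = 0" for i
    by (simp add: LS_integral_def set_lebesgue_integral_def)
  ultimately have "y d - y c = integral {c..d} k\<^sub>0 + (\<Sum>i\<in>UNIV. LS_integral (k i) (\<beta> i) c d)"
    by (simp add: \<psi>_def algebra_simps)
  then show "y d - y c = set_lebesgue_integral lborel {c..d} k\<^sub>0 + (\<Sum>i\<in>UNIV. LS_integral (k i) (\<beta> i) c d)"
    using set_borel_integral_eq_integral(2)[OF k0int] by simp
qed

section \<open>Transport of curves by a commuting flow\<close>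

text \<open>
  On the whole space the smooth extension is the function itself.
\<close>

lemma C_infinity_on_UNIV_imp_Ck_on:
  assumes "C_infinity_on UNIV f" shows "Ck_on k UNIV f"
proof -
  obtain U h where *: "UNIV \<subseteq> U" "\<forall>k. Ck_on k U h" "\<forall>x. f x = h x"
    using assms unfolding C_infinity_on_def by auto
  then have "f = h" "U = UNIV" by auto
  then show ?thesis using * by simp
qed

lemma C_infinity_on_imp_continuous_on:
  assumes "C_infinity_on S f" shows "continuous_on S f"
proof -
  obtain U h where *: "S \<subseteq> U" "\<forall>k. Ck_on k U h" "\<forall>x\<in>S. f x = h x"
    using assms unfolding C_infinity_on_def by auto
  have "Ck_on 0 U h" using *(2) by blast
  then have "continuous_on S h" using continuous_on_subset[OF _ *(1)] by simp
  then show ?thesis using * by (simp cong: continuous_on_cong)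
qed

lemma Ck_on_1_UNIV_derivative:
  assumes "Ck_on 1 UNIV f"
  shows "(f has_derivative frechet_derivative f (at x)) (at x)"
    and "continuous_on UNIV (\<lambda>x. frechet_derivative f (at x) v)"
    and "continuous_on S f"
proof -
  have d: "f differentiable (at x)" for x using assms by (simp add: One_nat_def del: One_nat_def[symmetric])
  show "(f has_derivative frechet_derivative f (at x)) (at x)"
    using d frechet_derivative_works by blast
  show "continuous_on UNIV (\<lambda>x. frechet_derivative f (at x) v)"
    using assms by (simp add: One_nat_def)
  show "continuous_on S f"
    using d differentiable_imp_continuous_within continuous_at_imp_continuous_on by blast
qed

lemma C1_lipschitz_on_compact_convex:
  fixes f :: "'a::euclidean_space \<Rightarrow> 'b::euclidean_space"
  assumes f: "Ck_on 1 UNIV f" and K: "compact K" "convex K"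
  shows "\<exists>L\<ge>0. \<forall>x\<in>K. \<forall>y\<in>K. norm (f x - f y) \<le> L * norm (x - y)"
proof -
  let ?D = "\<lambda>x. frechet_derivative f (at x)"
  have "\<exists>C\<ge>0. \<forall>x\<in>K. norm (?D x b) \<le> C" for b
  proof -
    have "bounded ((\<lambda>x. ?D x b) ` K)"
      using compact_continuous_image[OF continuous_on_subset[OF Ck_on_1_UNIV_derivative(2)[OF f]] K(1)] compact_imp_bounded by blast
    then show ?thesis unfolding bounded_pos by (auto intro: less_imp_le)
  qed
  then obtain C where C: "\<And>b. 0 \<le> C b" "\<And>b x. x \<in> K \<Longrightarrow> norm (?D x b) \<le> C b" by metis
  have "norm (f x - f y) \<le> (\<Sum>b\<in>Basis. C b) * norm (x - y)" if "x \<in> K" "y \<in> K" for x y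
  proof (rule differentiable_bound[OF K(2) _ _ that])
    show "(f has_derivative ?D x) (at x within K)" for x
      using Ck_on_1_UNIV_derivative(1)[OF f] has_derivative_at_withinI by blast
    show "onorm (?D x) \<le> (\<Sum>b\<in>Basis. C b)" if "x \<in> K" for x
      by (rule order_trans[OF onorm_componentwise[OF has_derivative_bounded_linear[OF Ck_on_1_UNIV_derivative(1)[OF f]]]
            sum_mono[OF C(2)[OF that]]])
  qed
  moreover have "0 \<le> (\<Sum>b\<in>Basis. C b)" using C by (simp add: sum_nonneg)
  ultimately show ?thesis by blast
qed

text \<open>
  The derivative is given through its values in fixed directions, so that uniform continuity on \<open>K\<close> is
  available for each basis vector only; the operator norm is bounded by the sum over the basis.
\<close>

lemma C1_uniform_taylor_on_compact_convex:
  fixes f :: "'a::euclidean_space \<Rightarrow> 'b::euclidean_space"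
  assumes f: "Ck_on 1 UNIV f" and K: "compact K" "convex K" and "e > 0"
  shows "\<exists>d>0. \<forall>x\<in>K. \<forall>v. x + v \<in> K \<and> norm v < d \<longrightarrow>
    norm (f (x + v) - f x - frechet_derivative f (at x) v) \<le> e * norm v"
proof -
  let ?D = "\<lambda>x. frechet_derivative f (at x)"
  define n where "n = real (card (Basis :: 'a set))"
  have "n > 0" by (simp add: n_def)
  have "\<exists>d>0. \<forall>b\<in>(Basis :: 'a set). \<forall>x\<in>K. \<forall>y\<in>K. dist y x < d \<longrightarrow> norm (?D y b - ?D x b) \<le> e / n"
  proof (rule ex_common_radius)
    fix b :: 'a
    have "uniformly_continuous_on K (\<lambda>x. ?D x b)"
      using compact_uniformly_continuous[OF continuous_on_subset[OF Ck_on_1_UNIV_derivative(2)[OF f]] K(1)] by blast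
    then obtain d where "d > 0" "\<forall>x\<in>K. \<forall>y\<in>K. dist y x < d \<longrightarrow> dist (?D y b) (?D x b) < e / n"
      using divide_pos_pos[OF \<open>e > 0\<close> \<open>n > 0\<close>] unfolding uniformly_continuous_on_def by blast
    then show "\<exists>d>0. \<forall>x\<in>K. \<forall>y\<in>K. dist y x < d \<longrightarrow> norm (?D y b - ?D x b) \<le> e / n"
      unfolding dist_norm[of "?D _ _"] by (intro exI[of _ d]) (blast intro: less_imp_le)
  next
    show "\<forall>x\<in>K. \<forall>y\<in>K. dist y x < d' \<longrightarrow> norm (?D y b - ?D x b) \<le> e / n"
      if "\<forall>x\<in>K. \<forall>y\<in>K. dist y x < d \<longrightarrow> norm (?D y b - ?D x b) \<le> e / n" "d' \<le> d" for b d d'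
      using that less_le_trans by blast
  qed simp
  then obtain d where "d > 0" and d: "\<And>b x y. b \<in> Basis \<Longrightarrow> x \<in> K \<Longrightarrow> y \<in> K \<Longrightarrow> dist y x < d \<Longrightarrow>
      norm (?D y b - ?D x b) \<le> e / n" by blast
  have "norm (f (x + v) - f x - ?D x v) \<le> e * norm v" if "x \<in> K" "x + v \<in> K" "norm v < d" for x v
  proof -
    let ?S = "K \<inter> ball x d"
    have "norm (f (x + v) - f x - ?D x (x + v - x)) \<le> norm (x + v - x) * e"
    proof (rule differentiable_bound_linearization[of x "x + v" ?S f ?D x e])
      show "x + t *\<^sub>R (x + v - x) \<in> ?S" if "t \<in> {0..1}" for t
      proof -
        have "(1 - t) *\<^sub>R x + t *\<^sub>R (x + v) \<in> K"
          using that \<open>x \<in> K\<close> \<open>x + v \<in> K\<close> K(2) by (intro convexD) auto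
        moreover have "(1 - t) *\<^sub>R x + t *\<^sub>R (x + v) = x + t *\<^sub>R (x + v - x)" by (simp add: algebra_simps)
        moreover have "\<bar>t\<bar> * norm v < d"
          using that \<open>norm v < d\<close> mult_left_le_one_le[of "norm v" t] by auto
        ultimately show ?thesis by (simp add: dist_norm)
      qed
      show "(f has_derivative ?D y) (at y within ?S)" for y
        using Ck_on_1_UNIV_derivative(1)[OF f] has_derivative_at_withinI by blast
      show "onorm (?D y - ?D x) \<le> e" if y: "y \<in> ?S" for y
      proof -
        have "bounded_linear (\<lambda>v. ?D y v - ?D x v)"
          by (intro bounded_linear_sub has_derivative_bounded_linear[OF Ck_on_1_UNIV_derivative(1)[OF f]])
        then have "onorm (\<lambda>v. ?D y v - ?D x v) \<le> (\<Sum>b\<in>Basis. norm (?D y b - ?D x b))"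
          by (rule onorm_componentwise)
        also have "\<dots> \<le> (\<Sum>b\<in>(Basis :: 'a set). e / n)"
          using y \<open>x \<in> K\<close> by (intro sum_mono d) (auto simp: dist_commute)
        also have "\<dots> = e" using \<open>n > 0\<close> by (simp add: n_def)
        finally show ?thesis by (simp add: fun_diff_def)
      qed
      show "x \<in> ?S" using \<open>x \<in> K\<close> \<open>d > 0\<close> by simp
    qed
    then show ?thesis by (simp add: mult.commute)
  qed
  then show ?thesis using \<open>d > 0\<close> by blast
qed

text \<open>
  A Gronwall estimate for the distance of a solution \<open>x\<close> of \<open>x' = f(x)\<close> from an approximate solution \<open>z\<close>.
  Working with the squared distance \<open>w\<close> keeps everything differentiable: by the Lipschitz bound and
  \<open>2 e |x - z| \<le> w + e\<^sup>2\<close> one has \<open>w' \<le> (2 L + 1) w + e\<^sup>2\<close>.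
\<close>

lemma approximate_solution_bound:
  fixes x z :: "real \<Rightarrow> 'a::real_inner"
  assumes "0 \<le> t" "0 \<le> L" "0 \<le> e"
    and x: "\<And>s. s \<in> {0..t} \<Longrightarrow> (x has_vector_derivative f (x s)) (at s)"
    and z: "\<And>s. s \<in> {0..t} \<Longrightarrow> (z has_vector_derivative z' s) (at s)"
    and defect: "\<And>s. s \<in> {0..t} \<Longrightarrow> norm (f (z s) - z' s) \<le> e"
    and K: "\<And>s. s \<in> {0..t} \<Longrightarrow> x s \<in> K" "\<And>s. s \<in> {0..t} \<Longrightarrow> z s \<in> K"
    and L: "\<And>p q. p \<in> K \<Longrightarrow> q \<in> K \<Longrightarrow> norm (f p - f q) \<le> L * norm (p - q)"
  shows "(norm (x t - z t))\<^sup>2 \<le> ((norm (x 0 - z 0))\<^sup>2 + e\<^sup>2 * t) * exp ((2 * L + 1) * t)"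
proof -
  define w where "w s = x s - z s" for s
  \<comment> \<open>The decreasing integrating factor turns the differential inequality into monotonicity of \<open>\<phi>\<close>.\<close>
  define \<phi> where "\<phi> s = (w s \<bullet> w s) * exp (- ((2 * L + 1) * s)) - e\<^sup>2 * s" for s
  have "\<phi> t \<le> \<phi> 0"
  proof (rule DERIV_nonpos_imp_nonincreasing[OF \<open>0 \<le> t\<close>])
    fix s assume "0 \<le> s" "s \<le> t"
    then have s: "s \<in> {0..t}" by simp
    define v where "v = f (x s) - z' s"
    have "(w has_vector_derivative v) (at s)"
      unfolding w_def v_def by (intro has_vector_derivative_diff x z s)
    then have w: "(w has_derivative (\<lambda>h. h *\<^sub>R v)) (at s)"
      by (simp add: has_vector_derivative_def)
    define D where "D = (2 * (w s \<bullet> v) - (2 * L + 1) * (w s \<bullet> w s)) * exp (- ((2 * L + 1) * s)) - e\<^sup>2"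
    have "((\<lambda>s. w s \<bullet> w s) has_real_derivative 2 * (w s \<bullet> v)) (at s)"
      unfolding has_field_derivative_def
      by (rule has_derivative_eq_rhs[OF has_derivative_inner[OF w w]])
        (auto simp: inner_commute algebra_simps)
    then have der: "(\<phi> has_real_derivative D) (at s)"
      unfolding \<phi>_def[abs_def] D_def by (auto intro!: derivative_eq_intros simp: algebra_simps)
    have "norm v \<le> L * norm (w s) + e"
    proof -
      have "v = (f (x s) - f (z s)) + (f (z s) - z' s)" by (simp add: v_def)
      also have "norm \<dots> \<le> L * norm (x s - z s) + e"
        by (intro order_trans[OF norm_triangle_ineq] add_mono L K s defect)
      finally show ?thesis by (simp add: w_def)
    qed
    then have "w s \<bullet> v \<le> norm (w s) * (L * norm (w s) + e)"
      by (intro order_trans[OF norm_cauchy_schwarz] mult_left_mono) auto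
    moreover have "2 * (norm (w s) * e) \<le> (norm (w s))\<^sup>2 + e\<^sup>2"
      using sum_squares_bound[of "norm (w s)" e] by simp
    ultimately have "2 * (w s \<bullet> v) - (2 * L + 1) * (w s \<bullet> w s) \<le> e\<^sup>2"
      by (simp add: power2_norm_eq_inner[symmetric] power2_eq_square algebra_simps)
    then have "(2 * (w s \<bullet> v) - (2 * L + 1) * (w s \<bullet> w s)) * exp (- ((2 * L + 1) * s))
        \<le> e\<^sup>2 * exp (- ((2 * L + 1) * s))"
      by (intro mult_right_mono) auto
    also have "\<dots> \<le> e\<^sup>2 * 1"
      using \<open>0 \<le> s\<close> \<open>0 \<le> L\<close> by (intro mult_left_mono) auto
    finally have "D \<le> 0" by (simp add: D_def)
    then show "\<exists>y. (\<phi> has_real_derivative y) (at s) \<and> y \<le> 0" using der by blast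
  qed
  then have "(w t \<bullet> w t) * exp (- ((2 * L + 1) * t)) \<le> (w 0 \<bullet> w 0) + e\<^sup>2 * t"
    by (simp add: \<phi>_def)
  then have "(w t \<bullet> w t) * exp (- ((2 * L + 1) * t)) * exp ((2 * L + 1) * t)
      \<le> ((w 0 \<bullet> w 0) + e\<^sup>2 * t) * exp ((2 * L + 1) * t)"
    by (intro mult_right_mono) auto
  moreover have "exp (- ((2 * L + 1) * t)) * exp ((2 * L + 1) * t) = 1"
    by (simp flip: exp_add)
  ultimately show ?thesis
    unfolding power2_norm_eq_inner w_def mult.assoc by simp
qed

text \<open>
  Along the orbit \<open>x(s) = \<Phi>(s)[z(r\<^sub>0)]\<close> the vanishing bracket says \<open>DX(x) f(x) = Df(x) X(x)\<close>. Hence, for small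
  \<open>h = r - r\<^sub>0\<close>, the curve \<open>x(s) + h X(x(s))\<close> satisfies the differential equation of \<open>f\<close> up to \<open>o(h)\<close>, and it starts
  within \<open>o(h)\<close> of \<open>z(r)\<close>. By the Gronwall estimate it stays within \<open>o(h)\<close> of \<open>\<Phi>(s)[z(r)]\<close>. Differentiability of the flow with respect to the
  initial value thus comes with its derivative in the direction \<open>X\<close>, which is \<open>X\<close> along the orbit. The gap between \<open>R'\<close> and \<open>R\<close> leaves room for the
  approximate solution in the ball.
\<close>

lemma commuting_flow_transports_derivative:
  fixes f X :: "'a::euclidean_space \<Rightarrow> 'a" and z :: "real \<Rightarrow> 'a"
  assumes f: "Ck_on 1 UNIV f" and flow: "is_flow f \<Phi>" and X: "Ck_on 1 UNIV X"
    and "0 \<le> t" and "R' < R"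
    and orbit: "\<And>s. s \<in> {0..t} \<Longrightarrow> \<Phi> s (z r\<^sub>0) \<in> cball c R'"
    and orbits: "\<And>r s. r \<in> S \<Longrightarrow> s \<in> {0..t} \<Longrightarrow> \<Phi> s (z r) \<in> cball c R"
    and commute: "\<And>s. s \<in> {0..t} \<Longrightarrow> lie_bracket f X (\<Phi> s (z r\<^sub>0)) = 0"
    and z: "(z has_vector_derivative X (z r\<^sub>0)) (at r\<^sub>0 within S)"
  shows "((\<lambda>r. \<Phi> t (z r)) has_vector_derivative X (\<Phi> t (z r\<^sub>0))) (at r\<^sub>0 within S)"
proof -
  let ?K = "cball c R"
  define x where "x s = \<Phi> s (z r\<^sub>0)" for s
  define \<delta> where "\<delta> = R - R'"
  have "\<delta> > 0" using \<open>R' < R\<close> by (simp add: \<delta>_def)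
  have \<Phi>0: "\<Phi> 0 p = p" and \<Phi>': "((\<lambda>s. \<Phi> s p) has_vector_derivative f (\<Phi> s p)) (at s)" for p s
    using flow by (auto simp: is_flow_def)
  have x': "(x has_vector_derivative f (x s)) (at s)" for s
    using \<Phi>' unfolding x_def .
  obtain L where "L \<ge> 0" and L: "\<And>p q. p \<in> ?K \<Longrightarrow> q \<in> ?K \<Longrightarrow> norm (f p - f q) \<le> L * norm (p - q)"
    using C1_lipschitz_on_compact_convex[OF f compact_cball convex_cball] by blast
  have "continuous_on {0..t} x"
    by (intro continuous_at_imp_continuous_on ballI has_vector_derivative_continuous[OF x'])
  then have "continuous_on {0..t} (\<lambda>s. X (x s))"
    by (intro continuous_on_compose2[OF Ck_on_1_UNIV_derivative(3)[OF X, of UNIV]]) auto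
  then have "bounded ((\<lambda>s. X (x s)) ` {0..t})"
    using compact_continuous_image compact_imp_bounded by blast
  then obtain M where "M > 0" and M: "\<And>s. s \<in> {0..t} \<Longrightarrow> norm (X (x s)) \<le> M"
    unfolding bounded_pos by auto
  define E where "E = (1 + M\<^sup>2 * t) * exp ((2 * L + 1) * t)"
  have "E > 0" unfolding E_def using \<open>0 \<le> t\<close> by (intro mult_pos_pos add_pos_nonneg) auto
  show ?thesis
    unfolding has_vector_derivative_def has_derivative_within_alt
  proof (intro conjI allI impI)
    fix e :: real assume "e > 0"
    \<comment> \<open>Initial error and defect at most \<open>\<eta> |h|\<close> and \<open>\<eta> M |h|\<close> add up to \<open>\<eta>\<^sup>2 E h\<^sup>2\<close> in the Gronwall estimate.\<close>
    define \<eta> where "\<eta> = e / sqrt E"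
    have "\<eta> > 0" and \<eta>: "\<eta>\<^sup>2 * E = e\<^sup>2"
      using \<open>e > 0\<close> \<open>E > 0\<close> by (auto simp: \<eta>_def power_divide)
    obtain d1 where "d1 > 0" and d1: "\<And>r. r \<in> S \<Longrightarrow> norm (r - r\<^sub>0) < d1 \<Longrightarrow>
        norm (z r - z r\<^sub>0 - (r - r\<^sub>0) *\<^sub>R X (z r\<^sub>0)) \<le> \<eta> * norm (r - r\<^sub>0)"
      using z \<open>\<eta> > 0\<close> unfolding has_vector_derivative_def has_derivative_within_alt by blast
    obtain d2 where "d2 > 0" and d2: "\<And>p v. p \<in> ?K \<Longrightarrow> p + v \<in> ?K \<Longrightarrow> norm v < d2 \<Longrightarrow>
        norm (f (p + v) - f p - frechet_derivative f (at p) v) \<le> \<eta> * norm v"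
      using C1_uniform_taylor_on_compact_convex[OF f compact_cball convex_cball \<open>\<eta> > 0\<close>] by blast
    define d where "d = min d1 (min (d2 / M) (\<delta> / M))"
    have "norm (\<Phi> t (z r) - \<Phi> t (z r\<^sub>0) - (r - r\<^sub>0) *\<^sub>R X (\<Phi> t (z r\<^sub>0))) \<le> e * norm (r - r\<^sub>0)"
      if "r \<in> S" "norm (r - r\<^sub>0) < d" for r
    proof -
      define h where "h = r - r\<^sub>0"
      have h: "\<bar>h\<bar> < d1" "\<bar>h\<bar> * M < d2" "\<bar>h\<bar> * M < \<delta>"
        using that(2) \<open>M > 0\<close> by (auto simp: h_def d_def field_simps)
      define p where "p s = x s + h *\<^sub>R X (x s)" for s
      define p' where "p' s = f (x s) + h *\<^sub>R frechet_derivative X (at (x s)) (f (x s))" for s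
      have hX: "norm (h *\<^sub>R X (x s)) \<le> \<bar>h\<bar> * M" if "s \<in> {0..t}" for s
        using M[OF that] by (simp add: mult_left_mono)
      have xK: "x s \<in> cball c R'" if "s \<in> {0..t}" for s using orbit[OF that] by (simp add: x_def)
      then have xK': "x s \<in> ?K" if "s \<in> {0..t}" for s using that \<open>R' < R\<close> by fastforce
      have pK: "p s \<in> ?K" if "s \<in> {0..t}" for s
      proof -
        have "dist c (p s) \<le> dist c (x s) + dist (x s) (p s)" by (rule dist_triangle)
        also have "dist (x s) (p s) \<le> \<delta>" using hX[OF that] h(3) by (simp add: p_def dist_norm)
        finally show ?thesis using xK[OF that] by (simp add: \<delta>_def)
      qed
      have pd: "(p has_vector_derivative p' s) (at s)" for s
      proof -
        have "((\<lambda>s. X (x s)) has_derivative (\<lambda>k. frechet_derivative X (at (x s)) (k *\<^sub>R f (x s)))) (at s)"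
          using x'[of s] unfolding has_vector_derivative_def
          by (rule has_derivative_compose[OF _ Ck_on_1_UNIV_derivative(1)[OF X]])
        then have "((\<lambda>s. X (x s)) has_vector_derivative frechet_derivative X (at (x s)) (f (x s))) (at s)"
          unfolding has_vector_derivative_def
          by (simp add: linear_scale[OF bounded_linear.linear[OF has_derivative_bounded_linear[OF Ck_on_1_UNIV_derivative(1)[OF X]]]])
        then show ?thesis
          unfolding p_def[abs_def] p'_def
          by (intro has_vector_derivative_add x' bounded_linear.has_vector_derivative[OF bounded_linear_scaleR_right])
      qed
      have defect: "norm (f (p s) - p' s) \<le> \<eta> * (\<bar>h\<bar> * M)" if s: "s \<in> {0..t}" for s
      proof -
        have "frechet_derivative X (at (x s)) (f (x s)) = frechet_derivative f (at (x s)) (X (x s))"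
          using commute[OF s] by (simp add: lie_bracket_def x_def)
        then have "h *\<^sub>R frechet_derivative X (at (x s)) (f (x s)) = frechet_derivative f (at (x s)) (h *\<^sub>R X (x s))"
          by (simp add: linear_scale[OF bounded_linear.linear[OF has_derivative_bounded_linear[OF Ck_on_1_UNIV_derivative(1)[OF f]]]])
        then have "norm (f (p s) - p' s) =
            norm (f (x s + h *\<^sub>R X (x s)) - f (x s) - frechet_derivative f (at (x s)) (h *\<^sub>R X (x s)))"
          by (simp add: p_def p'_def algebra_simps)
        also have "\<dots> \<le> \<eta> * norm (h *\<^sub>R X (x s))"
          using hX[OF s] h pK[OF s] xK'[OF s] by (intro d2) (auto simp: p_def)
        also have "\<dots> \<le> \<eta> * (\<bar>h\<bar> * M)" using hX[OF s] \<open>\<eta> > 0\<close> by (intro mult_left_mono) auto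
        finally show ?thesis .
      qed
      have init: "norm (\<Phi> 0 (z r) - p 0) \<le> \<eta> * \<bar>h\<bar>"
        using d1[OF that(1)] h(1) by (simp add: \<Phi>0 p_def x_def h_def algebra_simps)
      have "(norm (\<Phi> t (z r) - p t))\<^sup>2 \<le>
          ((norm (\<Phi> 0 (z r) - p 0))\<^sup>2 + (\<eta> * (\<bar>h\<bar> * M))\<^sup>2 * t) * exp ((2 * L + 1) * t)"
      proof (rule approximate_solution_bound[where f=f and K="?K" and z'=p'])
        show "((\<lambda>s. \<Phi> s (z r)) has_vector_derivative f (\<Phi> s (z r))) (at s)" for s by (rule \<Phi>')
        show "0 \<le> \<eta> * (\<bar>h\<bar> * M)" using \<open>\<eta> > 0\<close> \<open>M > 0\<close> by simp
      qed (fact \<open>0 \<le> t\<close> \<open>L \<ge> 0\<close> | rule pd | erule defect | erule orbits[OF that(1)] | erule pK | erule (1) L)+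
      also have "\<dots> \<le> ((\<eta> * \<bar>h\<bar>)\<^sup>2 + (\<eta> * (\<bar>h\<bar> * M))\<^sup>2 * t) * exp ((2 * L + 1) * t)"
        using init by (intro mult_right_mono add_right_mono power_mono) auto
      also have "\<dots> = (\<eta>\<^sup>2 * E) * \<bar>h\<bar>\<^sup>2"
        by (simp add: E_def power2_eq_square algebra_simps)
      also have "\<dots> = (e * \<bar>h\<bar>)\<^sup>2" unfolding \<eta> by (simp add: power_mult_distrib)
      finally have "norm (\<Phi> t (z r) - p t) \<le> e * \<bar>h\<bar>"
        by (rule power2_le_imp_le) (use \<open>e > 0\<close> in simp)
      then show ?thesis by (simp add: p_def x_def h_def algebra_simps)
    qed
    moreover have "d > 0" using \<open>d1 > 0\<close> \<open>d2 > 0\<close> \<open>\<delta> > 0\<close> \<open>M > 0\<close> by (simp add: d_def)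
    ultimately show "\<exists>d>0. \<forall>r\<in>S. norm (r - r\<^sub>0) < d \<longrightarrow>
        norm (\<Phi> t (z r) - \<Phi> t (z r\<^sub>0) - (r - r\<^sub>0) *\<^sub>R X (\<Phi> t (z r\<^sub>0))) \<le> e * norm (r - r\<^sub>0)"
      by blast
  qed (rule bounded_linear_scaleR_left)
qed

section \<open>Uniform first-order expansion on a box\<close>

lemma vector_mean_value_linearization:
  fixes f :: "real \<Rightarrow> 'b::real_normed_vector"
  assumes f: "\<And>x. x \<in> closed_segment a b \<Longrightarrow> (f has_vector_derivative f' x) (at x within S)"
    and S: "closed_segment a b \<subseteq> S"
    and e: "\<And>x. x \<in> closed_segment a b \<Longrightarrow> norm (f' x - c) \<le> e"
  shows "norm (f b - f a - (b - a) *\<^sub>R c) \<le> e * \<bar>b - a\<bar>"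
proof -
  have "norm ((f b - b *\<^sub>R c) - (f a - a *\<^sub>R c)) \<le> e * norm (b - a)"
  proof (rule differentiable_bound[where S="closed_segment a b" and f'="\<lambda>x h. h *\<^sub>R (f' x - c)"])
    show "((\<lambda>x. f x - x *\<^sub>R c) has_derivative (\<lambda>h. h *\<^sub>R (f' x - c))) (at x within closed_segment a b)"
      if "x \<in> closed_segment a b" for x
    proof -
      have "(f has_derivative (\<lambda>h. h *\<^sub>R f' x)) (at x within closed_segment a b)"
        using f[OF that] S has_derivative_subset unfolding has_vector_derivative_def by blast
      then show ?thesis
        by (auto intro!: derivative_eq_intros simp: scaleR_diff_right)
    qed
    show "onorm (\<lambda>h. h *\<^sub>R (f' x - c)) \<le> e" if "x \<in> closed_segment a b" for x
      using e[OF that] by (intro onorm_le) (simp add: mult.commute[of e] mult_left_mono)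
  qed auto
  then show ?thesis by (simp add: algebra_simps)
qed

text \<open>
  The coordinates are moved one at a time from \<open>p\<close> to \<open>q\<close>; each move stays in the box, where only the partial
  derivative in that coordinate enters.
\<close>

lemma box_mean_value_linearization:
  fixes F :: "real^'m \<Rightarrow> 'b::real_normed_vector" and D :: "real^'m \<Rightarrow> 'm \<Rightarrow> 'b"
  assumes der: "\<And>r j. r \<in> cbox l v \<Longrightarrow>
      ((\<lambda>s. F (\<chi> i. if i = j then s else r $ i)) has_vector_derivative D r j) (at (r $ j) within {l $ j..v $ j})"
    and pq: "p \<in> cbox l v" "q \<in> cbox l v"
    and e: "\<And>r j. r \<in> cbox l v \<Longrightarrow> (\<And>i. r $ i \<in> closed_segment (p $ i) (q $ i)) \<Longrightarrow> norm (D r j - c j) \<le> e"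
  shows "norm (F q - F p - (\<Sum>j\<in>UNIV. (q $ j - p $ j) *\<^sub>R c j)) \<le> e * (\<Sum>j\<in>UNIV. \<bar>q $ j - p $ j\<bar>)"
proof -
  define mix where "mix S = (\<chi> i. if i \<in> S then q $ i else p $ i)" for S
  have "norm (F (mix S) - F p - (\<Sum>j\<in>S. (q $ j - p $ j) *\<^sub>R c j)) \<le> e * (\<Sum>j\<in>S. \<bar>q $ j - p $ j\<bar>)" for S
    using finite[of S]
  proof (induction S)
    case empty
    have "mix {} = p" by (simp add: mix_def vec_eq_iff)
    then show ?case by simp
  next
    case (insert j S)
    define line where "line s = (\<chi> i. if i = j then s else mix S $ i)" for s
    have ends: "line (q $ j) = mix (insert j S)" "line (p $ j) = mix S"
      using insert(2) by (auto simp: line_def mix_def vec_eq_iff)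
    have seg: "closed_segment (p $ i) (q $ i) \<subseteq> {l $ i..v $ i}" for i
      using pq by (auto simp: mem_box_cart closed_segment_eq_real_ivl)
    have line_seg: "line s $ i \<in> closed_segment (p $ i) (q $ i)" if "s \<in> closed_segment (p $ j) (q $ j)" for s i
      using that by (auto simp: line_def mix_def)
    have line_box: "line s \<in> cbox l v" if "s \<in> closed_segment (p $ j) (q $ j)" for s
      using line_seg[OF that] seg by (fastforce simp: mem_box_cart)
    have "norm (F (line (q $ j)) - F (line (p $ j)) - (q $ j - p $ j) *\<^sub>R c j) \<le> e * \<bar>q $ j - p $ j\<bar>"
    proof (rule vector_mean_value_linearization[where S="{l $ j..v $ j}" and f'="\<lambda>s. D (line s) j"])
      fix s assume s: "s \<in> closed_segment (p $ j) (q $ j)"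
      have "(\<lambda>s'. F (\<chi> i. if i = j then s' else line s $ i)) = (\<lambda>s. F (line s))"
        by (intro ext arg_cong[of _ _ F]) (simp add: line_def vec_eq_iff)
      moreover have "line s $ j = s" by (simp add: line_def)
      ultimately show "((\<lambda>s. F (line s)) has_vector_derivative D (line s) j) (at s within {l $ j..v $ j})"
        using der[OF line_box[OF s], of j] by simp
      show "norm (D (line s) j - c j) \<le> e"
        by (rule e[OF line_box[OF s] line_seg[OF s]])
    qed (rule seg)
    then have "norm (F (mix (insert j S)) - F (mix S) - (q $ j - p $ j) *\<^sub>R c j) \<le> e * \<bar>q $ j - p $ j\<bar>"
      unfolding ends .
    then have "norm ((F (mix (insert j S)) - F (mix S) - (q $ j - p $ j) *\<^sub>R c j) +
        (F (mix S) - F p - (\<Sum>j\<in>S. (q $ j - p $ j) *\<^sub>R c j)))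
       \<le> e * \<bar>q $ j - p $ j\<bar> + e * (\<Sum>j\<in>S. \<bar>q $ j - p $ j\<bar>)"
      using insert(3) by (rule norm_triangle_le[OF add_mono])
    then show ?case
      using insert(1,2) by (simp add: algebra_simps)
  qed
  from this[of UNIV] show ?thesis by (simp add: mix_def vec_lambda_eta)
qed

text \<open>
  The partial derivatives depend on \<open>F\<close> itself. Since \<open>F\<close> has values in a compact set they are bounded, so
  that the mean value estimate, used first around \<open>0\<close>, makes \<open>F\<close> Lipschitz continuous. The partial
  derivatives are therefore uniformly continuous, and the same estimate around their values at \<open>(s, p)\<close> is
  the expansion.
\<close>

lemma uniform_expansion_on_box:
  fixes F :: "real \<Rightarrow> real^'m \<Rightarrow> 'b::real_normed_vector"
    and k\<^sub>0 :: "'b \<Rightarrow> 'b" and k :: "'i::finite \<Rightarrow> 'b \<Rightarrow> 'b" and B :: "'i \<Rightarrow> 'm \<Rightarrow> real^'m \<Rightarrow> real"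
  assumes time: "\<And>t p. t \<in> {0..T} \<Longrightarrow> p \<in> cbox l v \<Longrightarrow>
      ((\<lambda>t. F t p) has_vector_derivative k\<^sub>0 (F t p)) (at t within {0..T})"
    and space: "\<And>t p j. t \<in> {0..T} \<Longrightarrow> p \<in> cbox l v \<Longrightarrow>
      ((\<lambda>s. F t (\<chi> i. if i = j then s else p $ i)) has_vector_derivative
        (\<Sum>i\<in>UNIV. B i j p *\<^sub>R k i (F t p))) (at (p $ j) within {l $ j..v $ j})"
    and K: "compact K" "\<And>t p. t \<in> {0..T} \<Longrightarrow> p \<in> cbox l v \<Longrightarrow> F t p \<in> K"
    and k0: "continuous_on K k\<^sub>0" and k: "\<And>i. continuous_on K (k i)"
    and B: "\<And>i j. continuous_on (cbox l v) (B i j)"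
  shows "continuous_on ({0..T} \<times> cbox l v) (\<lambda>(t, p). F t p)"
    and "e > 0 \<Longrightarrow> \<exists>\<delta>>0. \<forall>s\<in>{0..T}. \<forall>t\<in>{0..T}. \<forall>p\<in>cbox l v. \<forall>q\<in>cbox l v.
      \<bar>t - s\<bar> < \<delta> \<and> norm (q - p) < \<delta> \<longrightarrow>
      norm (F t q - F s p - (t - s) *\<^sub>R k\<^sub>0 (F s p) -
        (\<Sum>j\<in>UNIV. (q $ j - p $ j) *\<^sub>R (\<Sum>i\<in>UNIV. B i j p *\<^sub>R k i (F s p))))
      \<le> e * (\<bar>t - s\<bar> + (\<Sum>j\<in>UNIV. \<bar>q $ j - p $ j\<bar>))"
proof -
  let ?Q = "cbox l v" and ?D = "\<lambda>t p j. \<Sum>i\<in>UNIV. B i j p *\<^sub>R k i (F t p)"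
  have seg: "closed_segment s t \<subseteq> {0..T}" if "s \<in> {0..T}" "t \<in> {0..T}" for s t
    using that by (auto simp: closed_segment_eq_real_ivl)
  have increment: "norm (F t q - F s p - (t - s) *\<^sub>R c\<^sub>0 - (\<Sum>j\<in>UNIV. (q $ j - p $ j) *\<^sub>R c j))
      \<le> e * (\<bar>t - s\<bar> + (\<Sum>j\<in>UNIV. \<bar>q $ j - p $ j\<bar>))"
    if st: "s \<in> {0..T}" "t \<in> {0..T}" and pq: "p \<in> ?Q" "q \<in> ?Q"
      and e0: "\<And>r. r \<in> closed_segment s t \<Longrightarrow> norm (k\<^sub>0 (F r p) - c\<^sub>0) \<le> e"
      and e1: "\<And>r j. r \<in> ?Q \<Longrightarrow> (\<And>i. r $ i \<in> closed_segment (p $ i) (q $ i)) \<Longrightarrow> norm (?D t r j - c j) \<le> e"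
    for s t p q c\<^sub>0 c e
  proof -
    have "norm (F t p - F s p - (t - s) *\<^sub>R c\<^sub>0) \<le> e * \<bar>t - s\<bar>"
      by (rule vector_mean_value_linearization[where S="{0..T}", OF time _ e0]) (use st pq seg[OF st] in auto)
    moreover have "norm (F t q - F t p - (\<Sum>j\<in>UNIV. (q $ j - p $ j) *\<^sub>R c j)) \<le> e * (\<Sum>j\<in>UNIV. \<bar>q $ j - p $ j\<bar>)"
      by (rule box_mean_value_linearization[OF space pq e1]) (use st in auto)
    ultimately have "norm ((F t p - F s p - (t - s) *\<^sub>R c\<^sub>0) + (F t q - F t p - (\<Sum>j\<in>UNIV. (q $ j - p $ j) *\<^sub>R c j)))
        \<le> e * \<bar>t - s\<bar> + e * (\<Sum>j\<in>UNIV. \<bar>q $ j - p $ j\<bar>)"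
      by (rule norm_triangle_le[OF add_mono])
    then show ?thesis by (simp add: algebra_simps)
  qed
  have bounded_on: "\<exists>C\<ge>0. \<forall>x\<in>S. norm (f x) \<le> C" if "compact S" "continuous_on S f"
    for S and f :: "'x::metric_space \<Rightarrow> 'y::real_normed_vector"
    using compact_imp_bounded[OF compact_continuous_image[OF that(2,1)]]
    unfolding bounded_pos by (auto intro: less_imp_le)
  obtain C0 where C0: "0 \<le> C0" "\<And>x. x \<in> K \<Longrightarrow> norm (k\<^sub>0 x) \<le> C0"
    using bounded_on[OF K(1) k0] by blast
  obtain Ck where Ck: "\<And>i. 0 \<le> Ck i" "\<And>i x. x \<in> K \<Longrightarrow> norm (k i x) \<le> Ck i"
    using bounded_on[OF K(1) k] by metis
  obtain CB where CB: "\<And>i j. 0 \<le> CB i j" "\<And>i j x. x \<in> ?Q \<Longrightarrow> norm (B i j x) \<le> CB i j"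
    using bounded_on[OF compact_cbox B] by metis
  define C where "C = C0 + (\<Sum>j\<in>UNIV. \<Sum>i\<in>UNIV. CB i j * Ck i)"
  have term0: "0 \<le> (\<Sum>i\<in>UNIV. CB i j * Ck i)" for j using CB Ck by (simp add: sum_nonneg)
  have C: "0 \<le> C" "C0 \<le> C" "(\<Sum>i\<in>UNIV. CB i j * Ck i) \<le> C" for j
    using C0(1) sum_nonneg[of UNIV "\<lambda>j. \<Sum>i\<in>UNIV. CB i j * Ck i", OF term0]
      member_le_sum[of j UNIV "\<lambda>j. \<Sum>i\<in>UNIV. CB i j * Ck i"] term0
    by (auto simp: C_def)
  have D_le: "norm (?D t p j) \<le> C" if "t \<in> {0..T}" "p \<in> ?Q" for t p j
  proof -
    have "norm (?D t p j) \<le> (\<Sum>i\<in>UNIV. CB i j * Ck i)"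
    proof (rule sum_norm_le)
      show "norm (B i j p *\<^sub>R k i (F t p)) \<le> CB i j * Ck i" for i
        using CB(2)[OF that(2), of i j] Ck(2)[OF K(2)[OF that], of i] CB(1)[of i j]
        by (simp add: mult_mono)
    qed
    then show ?thesis using C(3)[of j] by simp
  qed
  define m where "m = real CARD('m)"
  have l1: "(\<Sum>j\<in>UNIV. \<bar>q $ j - p $ j\<bar>) \<le> m * norm (q - p)" for p q :: "real^'m"
  proof -
    have "(\<Sum>j\<in>UNIV. \<bar>q $ j - p $ j\<bar>) \<le> (\<Sum>j\<in>(UNIV::'m set). norm (q - p))"
      using component_le_norm_cart[of "q - p"] by (intro sum_mono) simp
    then show ?thesis by (simp add: m_def)
  qed
  have "(C * (1 + m))-lipschitz_on ({0..T} \<times> ?Q) (\<lambda>(t, p). F t p)"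
  proof (rule lipschitz_onI)
    fix x y assume x: "x \<in> {0..T} \<times> ?Q" and y: "y \<in> {0..T} \<times> ?Q"
    obtain t q s p where eq: "x = (t, q)" "y = (s, p)" by (metis surj_pair)
    have tq: "t \<in> {0..T}" "q \<in> ?Q" "s \<in> {0..T}" "p \<in> ?Q" using x y eq by auto
    have "norm (F t q - F s p) \<le> C * (\<bar>t - s\<bar> + (\<Sum>j\<in>UNIV. \<bar>q $ j - p $ j\<bar>))"
      using increment[OF tq(3,1,4,2), of 0 C "\<lambda>_. 0"] D_le tq C0(2) K(2) C(2) seg[OF tq(3,1)]
      by (simp add: subset_iff) (meson order_trans)
    also have "\<dots> \<le> C * (dist x y + m * dist x y)"
    proof (intro mult_left_mono add_mono)
      show "\<bar>t - s\<bar> \<le> dist x y" using dist_fst_le[of x y] by (simp add: eq dist_real_def)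
      have "norm (q - p) \<le> dist x y" using dist_snd_le[of x y] by (simp add: eq dist_norm)
      then show "(\<Sum>j\<in>UNIV. \<bar>q $ j - p $ j\<bar>) \<le> m * dist x y"
        by (intro order_trans[OF l1] mult_left_mono) (auto simp: m_def)
    qed (rule C)
    finally show "dist (case x of (t, p) \<Rightarrow> F t p) (case y of (t, p) \<Rightarrow> F t p) \<le> C * (1 + m) * dist x y"
      by (simp add: eq dist_norm algebra_simps)
  qed (use C in \<open>simp add: m_def\<close>)
  then show cont: "continuous_on ({0..T} \<times> ?Q) (\<lambda>(t, p). F t p)"
    by (rule lipschitz_on_continuous_on)
  assume "e > 0"
  have comp: "compact ({0..T} \<times> ?Q)" by (intro compact_Times) auto
  have inK: "(\<lambda>(t, p). F t p) ` ({0..T} \<times> ?Q) \<subseteq> K" using K(2) by auto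
  have contF: "continuous_on ({0..T} \<times> ?Q) (\<lambda>x. f (F (fst x) (snd x)))" if "continuous_on K f" for f :: "'b \<Rightarrow> 'b"
    using continuous_on_compose2[OF that cont inK] by (simp add: case_prod_beta)
  have uc: "\<exists>\<delta>>0. \<forall>x\<in>{0..T} \<times> ?Q. \<forall>y\<in>{0..T} \<times> ?Q. dist y x < \<delta> \<longrightarrow> norm (f y - f x) \<le> e"
    if fc: "continuous_on ({0..T} \<times> ?Q) f" for f :: "real \<times> (real^'m) \<Rightarrow> 'b"
  proof -
    obtain \<delta> where "\<delta> > 0" "\<forall>x\<in>{0..T} \<times> ?Q. \<forall>y\<in>{0..T} \<times> ?Q. dist y x < \<delta> \<longrightarrow> dist (f y) (f x) < e"
      using compact_uniformly_continuous[OF fc comp] \<open>e > 0\<close> unfolding uniformly_continuous_on_def by blast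
    then show ?thesis unfolding dist_norm[of "f _"] by (intro exI[of _ \<delta>]) (blast intro: less_imp_le)
  qed
  obtain \<delta>0 where "\<delta>0 > 0" and \<delta>0: "\<And>x y. x \<in> {0..T} \<times> ?Q \<Longrightarrow> y \<in> {0..T} \<times> ?Q \<Longrightarrow> dist y x < \<delta>0 \<Longrightarrow>
      norm (k\<^sub>0 (F (fst y) (snd y)) - k\<^sub>0 (F (fst x) (snd x))) \<le> e"
    using uc[OF contF[OF k0]] by blast
  have "\<exists>\<delta>>0. \<forall>j\<in>UNIV. \<forall>x\<in>{0..T} \<times> ?Q. \<forall>y\<in>{0..T} \<times> ?Q. dist y x < \<delta> \<longrightarrow>
      norm (?D (fst y) (snd y) j - ?D (fst x) (snd x) j) \<le> e"
  proof (rule ex_common_radius)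
    fix j
    show "\<exists>\<delta>>0. \<forall>x\<in>{0..T} \<times> ?Q. \<forall>y\<in>{0..T} \<times> ?Q. dist y x < \<delta> \<longrightarrow>
      norm (?D (fst y) (snd y) j - ?D (fst x) (snd x) j) \<le> e"
      by (rule uc) (intro continuous_intros contF[OF k] continuous_on_compose2[OF B], auto)
  next
    show "\<forall>x\<in>{0..T} \<times> ?Q. \<forall>y\<in>{0..T} \<times> ?Q. dist y x < d' \<longrightarrow>
        norm (?D (fst y) (snd y) j - ?D (fst x) (snd x) j) \<le> e"
      if "\<forall>x\<in>{0..T} \<times> ?Q. \<forall>y\<in>{0..T} \<times> ?Q. dist y x < d \<longrightarrow>
        norm (?D (fst y) (snd y) j - ?D (fst x) (snd x) j) \<le> e" "d' \<le> d" for j d d'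
      using that less_le_trans by blast
  qed simp
  then obtain \<delta>1 where "\<delta>1 > 0" and \<delta>1: "\<And>j x y. x \<in> {0..T} \<times> ?Q \<Longrightarrow> y \<in> {0..T} \<times> ?Q \<Longrightarrow> dist y x < \<delta>1 \<Longrightarrow>
      norm (?D (fst y) (snd y) j - ?D (fst x) (snd x) j) \<le> e" by blast
  \<comment> \<open>Half of the radius for each of the two components of a pair.\<close>
  define \<delta> where "\<delta> = min \<delta>0 \<delta>1 / 2"
  have "\<delta> > 0" using \<open>\<delta>0 > 0\<close> \<open>\<delta>1 > 0\<close> by (simp add: \<delta>_def)
  show "\<exists>\<delta>>0. \<forall>s\<in>{0..T}. \<forall>t\<in>{0..T}. \<forall>p\<in>?Q. \<forall>q\<in>?Q. \<bar>t - s\<bar> < \<delta> \<and> norm (q - p) < \<delta> \<longrightarrow>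
      norm (F t q - F s p - (t - s) *\<^sub>R k\<^sub>0 (F s p) - (\<Sum>j\<in>UNIV. (q $ j - p $ j) *\<^sub>R ?D s p j))
      \<le> e * (\<bar>t - s\<bar> + (\<Sum>j\<in>UNIV. \<bar>q $ j - p $ j\<bar>))"
  proof (intro exI[of _ \<delta>] conjI ballI impI \<open>\<delta> > 0\<close>)
    fix s t p q assume st: "s \<in> {0..T}" "t \<in> {0..T}" and pq: "p \<in> ?Q" "q \<in> ?Q"
      and close: "\<bar>t - s\<bar> < \<delta> \<and> norm (q - p) < \<delta>"
    have dist_le: "dist (r', r) (s, p) < min \<delta>0 \<delta>1" if "\<bar>r' - s\<bar> < \<delta>" "norm (r - p) < \<delta>" for r' r
    proof -
      have "dist (r', r) (s, p) \<le> \<bar>r' - s\<bar> + norm (r - p)"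
        unfolding dist_Pair_Pair using sqrt_sum_squares_le_sum_abs[of "\<bar>r' - s\<bar>" "norm (r - p)"] by (simp add: dist_norm)
      then show ?thesis using that unfolding \<delta>_def by linarith
    qed
    show "norm (F t q - F s p - (t - s) *\<^sub>R k\<^sub>0 (F s p) - (\<Sum>j\<in>UNIV. (q $ j - p $ j) *\<^sub>R ?D s p j))
      \<le> e * (\<bar>t - s\<bar> + (\<Sum>j\<in>UNIV. \<bar>q $ j - p $ j\<bar>))"
    proof (rule increment[OF st pq])
      fix r assume r: "r \<in> closed_segment s t"
      then have "\<bar>r - s\<bar> < \<delta>" "r \<in> {0..T}"
        using close seg[OF st] by (auto simp: closed_segment_eq_real_ivl split: if_splits)
      then show "norm (k\<^sub>0 (F r p) - k\<^sub>0 (F s p)) \<le> e"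
        using \<delta>0[of "(s, p)" "(r, p)"] dist_le[of r p] st pq \<open>\<delta> > 0\<close> by simp
    next
      fix r j assume r: "r \<in> ?Q" "\<And>i. r $ i \<in> closed_segment (p $ i) (q $ i)"
      have "norm (r - p) \<le> norm (q - p)"
      proof (rule norm_le_componentwise_cart)
        show "norm ((r - p) $ i) \<le> norm ((q - p) $ i)" for i
          using r(2)[of i] by (auto simp: closed_segment_eq_real_ivl split: if_splits)
      qed
      then show "norm (?D t r j - ?D s p j) \<le> e"
        using \<delta>1[of "(s, p)" "(t, r)" j] dist_le[of t r] close st pq r by simp
    qed
  qed
qed

section \<open>Piecewise continuous integrands\<close>

lemma partition_cell:
  fixes \<tau> :: "nat \<Rightarrow> real"
  assumes "\<tau> 0 \<le> t" "t < \<tau> N"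
  shows "\<exists>k<N. \<tau> k \<le> t \<and> t < \<tau> (Suc k)"
  using assms(2)
proof (induction N)
  case 0
  then show ?case using assms(1) by simp
next
  case (Suc N)
  then show ?case by (cases "t < \<tau> N") (auto intro: less_SucI)
qed

lemma set_borel_measurable_piecewise_continuous:
  fixes f :: "real \<Rightarrow> real"
  assumes "\<And>k. k < N \<Longrightarrow> \<tau> k \<le> \<tau> (Suc k)"
    and f: "\<And>k. k < N \<Longrightarrow> continuous_on {\<tau> k..<\<tau> (Suc k)} f"
  shows "set_borel_measurable borel {\<tau> 0..<\<tau> N} f"
  using assms
proof (induction N)
  case 0
  then show ?case by (simp add: set_borel_measurable_def)
next
  case (Suc N)
  have "\<tau> 0 \<le> \<tau> N" using partition_mono[of N \<tau> 0 N] Suc.prems(1) by simp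
  then have *: "indicator {\<tau> 0..<\<tau> (Suc N)} x = indicator {\<tau> 0..<\<tau> N} x + (indicator {\<tau> N..<\<tau> (Suc N)} x :: real)" for x
    using Suc.prems(1)[of N] by (auto split: split_indicator)
  have 1: "(\<lambda>x. indicator {\<tau> 0..<\<tau> N} x *\<^sub>R f x) \<in> borel_measurable borel"
    using Suc.IH Suc.prems by (simp add: set_borel_measurable_def)
  have 2: "(\<lambda>x. indicator {\<tau> N..<\<tau> (Suc N)} x *\<^sub>R f x) \<in> borel_measurable borel"
    using Suc.prems by (intro borel_measurable_continuous_on_indicator) auto
  show ?case
    unfolding set_borel_measurable_def * scaleR_add_left by (intro borel_measurable_add 1 2)
qed

section \<open>The differential equation for the perturbed flow\<close>

text \<open>
  As long as the budget \<open>R\<close> for the total displacement is not exceeded, every intermediate point lies in the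
  ball where the bound for the next map applies.
\<close>

lemma foldr_displacement:
  fixes x :: "'a::real_normed_vector"
  assumes near: "\<And>i z. z \<in> cball c R \<Longrightarrow> norm (\<Phi> i z - z) \<le> \<kappa>"
    and x: "dist c x + real (length xs) * \<kappa> \<le> R" and "0 \<le> \<kappa>"
  shows "norm (foldr \<Phi> xs x - x) \<le> real (length xs) * \<kappa>"
  using x
proof (induction xs)
  case (Cons i ys)
  define z where "z = foldr \<Phi> ys x"
  have IH: "norm (z - x) \<le> real (length ys) * \<kappa>"
    unfolding z_def using Cons \<open>0 \<le> \<kappa>\<close> by (intro Cons.IH) (auto simp: algebra_simps)
  have "dist c z \<le> dist c x + norm (z - x)"
    using dist_triangle[of c z x] by (simp add: dist_norm norm_minus_commute)
  then have "z \<in> cball c R" using IH Cons.prems \<open>0 \<le> \<kappa>\<close> by (auto simp: algebra_simps)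
  then have "norm (\<Phi> i z - z) \<le> \<kappa>" by (rule near)
  then have "norm ((\<Phi> i z - z) + (z - x)) \<le> \<kappa> + real (length ys) * \<kappa>"
    using IH by (rule norm_triangle_le[OF add_mono])
  then show ?case by (simp add: z_def algebra_simps)
qed simp

text \<open>
  The coefficients are constants, so that no derivatives of them occur in the bracket.
\<close>

lemma C1_linear_combination:
  fixes g :: "'i::finite \<Rightarrow> 'a::euclidean_space \<Rightarrow> 'a"
  assumes g: "\<And>i. Ck_on 1 UNIV (g i)"
  shows "Ck_on 1 UNIV (\<lambda>x. \<Sum>i\<in>UNIV. b i *\<^sub>R g i x)"
    and "lie_bracket f (\<lambda>x. \<Sum>i\<in>UNIV. b i *\<^sub>R g i x) x =
      (\<Sum>i\<in>UNIV. b i *\<^sub>R frechet_derivative (g i) (at x) (f x)) - frechet_derivative f (at x) (\<Sum>i\<in>UNIV. b i *\<^sub>R g i x)"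
proof -
  have der: "((\<lambda>x. \<Sum>i\<in>UNIV. b i *\<^sub>R g i x) has_derivative
      (\<lambda>v. \<Sum>i\<in>UNIV. b i *\<^sub>R frechet_derivative (g i) (at x) v)) (at x)" for x
    by (intro has_derivative_sum has_derivative_scaleR_right Ck_on_1_UNIV_derivative(1)[OF g])
  note fd = frechet_derivative_at[OF der, symmetric]
  have "continuous_on UNIV (\<lambda>x. \<Sum>i\<in>UNIV. b i *\<^sub>R frechet_derivative (g i) (at x) v)" for v
    by (intro continuous_intros Ck_on_1_UNIV_derivative(2)[OF g])
  then show "Ck_on 1 UNIV (\<lambda>x. \<Sum>i\<in>UNIV. b i *\<^sub>R g i x)"
    using der unfolding One_nat_def Ck_on.simps fd differentiable_def by blast
  show "lie_bracket f (\<lambda>x. \<Sum>i\<in>UNIV. b i *\<^sub>R g i x) x =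
      (\<Sum>i\<in>UNIV. b i *\<^sub>R frechet_derivative (g i) (at x) (f x)) - frechet_derivative f (at x) (\<Sum>i\<in>UNIV. b i *\<^sub>R g i x)"
    unfolding lie_bracket_def fd ..
qed

lemma lie_bracket_linear_combination:
  fixes g :: "'i::finite \<Rightarrow> 'a::euclidean_space \<Rightarrow> 'a"
  assumes f: "Ck_on 1 UNIV f" and g: "\<And>i. Ck_on 1 UNIV (g i)"
  shows "lie_bracket f (\<lambda>x. \<Sum>i\<in>UNIV. b i *\<^sub>R g i x) x = (\<Sum>i\<in>UNIV. b i *\<^sub>R lie_bracket f (g i) x)"
proof -
  have lin: "linear (frechet_derivative f (at x))"
    by (intro bounded_linear.linear has_derivative_bounded_linear[OF Ck_on_1_UNIV_derivative(1)[OF f]])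
  show ?thesis
    unfolding C1_linear_combination(2)[OF g] linear_sum[OF lin] linear_scale[OF lin]
    by (simp add: lie_bracket_def scaleR_diff_right sum_subtractf)
qed

theorem theorem3p1:
  fixes g\<^sub>0 :: "real^'n \<Rightarrow> real^'n"
    and g :: "'m::{finite,linorder} \<Rightarrow> real^'n \<Rightarrow> real^'n"
    and G\<^sub>0 :: "real \<Rightarrow> real^'n \<Rightarrow> real^'n"
    and G :: "'m \<Rightarrow> real \<Rightarrow> real^'n \<Rightarrow> real^'n"
    and x\<^sub>s :: "real^'n"
    and \<gamma> T K\<^sub>1 :: real
    and a :: "real^'m::{finite,linorder}"
    and A :: "real^'m::{finite,linorder} \<Rightarrow> real^'m::{finite,linorder}^'m::{finite,linorder}"
    and u :: "real \<Rightarrow> real^'n \<Rightarrow> real^'m::{finite,linorder}"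
    and N :: nat and \<tau> :: "nat \<Rightarrow> real"
    and y :: "real \<Rightarrow> real^'n \<Rightarrow> real^'n"
  assumes "C_infinity_on UNIV g\<^sub>0" and "\<And>i. C_infinity_on UNIV (g i)"
    and "is_flow g\<^sub>0 G\<^sub>0" and "\<And>i. is_flow (g i) (G i)"
    and "\<gamma> > 0" and "T > 0" and "\<And>i. a $ i > 0" and "K\<^sub>1 > 0"
    and I1_involution: "involution_over_reals_on (cball x\<^sub>s (3 * \<gamma>)) g"
    and I1_commute: "\<And>x i. x \<in> cball x\<^sub>s (3 * \<gamma>) \<Longrightarrow> lie_bracket g\<^sub>0 (g i) x = 0"
    and I2_admissible: "u \<in> admissible_perturbations a K\<^sub>1"
    and I2_variation: "\<And>\<xi> i. bounded_variation_on (\<lambda>t. u t \<xi> $ i) 0 T"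
    and I2_G0: "\<And>x t. x \<in> cball x\<^sub>s (3 * \<gamma>) \<Longrightarrow> \<bar>t\<bar> \<le> T \<Longrightarrow>
      norm (G\<^sub>0 t x - x) \<le> \<gamma> / (2 * (real CARD('m) + 1))"
    and I2_G: "\<And>x i t. x \<in> cball x\<^sub>s (3 * \<gamma>) \<Longrightarrow> \<bar>t\<bar> \<le> a $ i \<Longrightarrow>
      norm (G i t x - x) \<le> \<gamma> / (2 * (real CARD('m) + 1))"
    and "gradient_representation g G a (cball x\<^sub>s (2 * \<gamma>)) A"
    and "continuity_partition u T N \<tau>"
    and y_def: "\<And>t \<xi>. t \<in> {0..T} \<Longrightarrow> \<xi> \<in> cball x\<^sub>s (2 * \<gamma>) \<Longrightarrow>
      y t \<xi> = G\<^sub>0 t (flow_comp G (u t \<xi>) \<xi>)"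
  shows "(\<forall>t\<in>{0..T}. \<forall>\<xi>\<in>cball x\<^sub>s (2 * \<gamma>). y t \<xi> \<in> cball x\<^sub>s (3 * \<gamma>)) \<and>
    (\<forall>\<xi>\<in>cball x\<^sub>s (2 * \<gamma>).
       (\<forall>k<N. satisfies_differential_equation_on {\<tau> k..<\<tau> (Suc k)}
          g\<^sub>0 g (\<lambda>i t. beta A u i t \<xi>) (\<lambda>t. y t \<xi>)) \<and>
       y 0 \<xi> = \<xi>)"
proof -
  define m where "m = real CARD('m)"
  define \<kappa> where "\<kappa> = \<gamma> / (2 * (m + 1))"
  define Q where "Q = cbox (- a) a"
  define K where "K = cball x\<^sub>s (3 * \<gamma>)"
  define Z where "Z \<xi> p = flow_comp G p \<xi>" for \<xi> p
  define F where "F \<xi> t p = G\<^sub>0 t (Z \<xi> p)" for \<xi> t p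
  have m: "m > 0" by (simp add: m_def)
  then have \<kappa>: "\<kappa> > 0" "(m + 1) * \<kappa> = \<gamma> / 2" using \<open>\<gamma> > 0\<close> by (auto simp: \<kappa>_def field_simps)
  have Q: "p \<in> Q \<longleftrightarrow> (\<forall>i. \<bar>p $ i\<bar> \<le> a $ i)" for p by (auto simp: Q_def mem_box_cart abs_le_iff minus_le_iff)
  note G0 = I2_G0[folded K_def m_def, folded \<kappa>_def] and G = I2_G[folded K_def m_def, folded \<kappa>_def]
  have g0_C1: "Ck_on 1 UNIV g\<^sub>0" and g_C1: "Ck_on 1 UNIV (g i)" for i
    using assms(1,2) C_infinity_on_UNIV_imp_Ck_on by blast+

  have Z_near: "dist x\<^sub>s (Z \<xi> p) \<le> 2 * \<gamma> + m * \<kappa>" if "\<xi> \<in> cball x\<^sub>s (2 * \<gamma>)" "p \<in> Q" for \<xi> p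
  proof -
    let ?xs = "sorted_list_of_set (UNIV :: 'm set)"
    have len: "real (length ?xs) = m" by (simp add: m_def)
    have "norm (Z \<xi> p - \<xi>) \<le> real (length ?xs) * \<kappa>"
      unfolding Z_def flow_comp_def
    proof (rule foldr_displacement[where c=x\<^sub>s and R="3 * \<gamma>"])
      show "norm (G i (p $ i) z - z) \<le> \<kappa>" if "z \<in> cball x\<^sub>s (3 * \<gamma>)" for i z
        using G[of z "p $ i" i] that \<open>p \<in> Q\<close> by (simp add: Q K_def)
      show "dist x\<^sub>s \<xi> + real (length ?xs) * \<kappa> \<le> 3 * \<gamma>"
        using that(1) \<kappa> \<open>\<gamma> > 0\<close> unfolding len by (simp add: algebra_simps)
    qed (use \<kappa> in auto)
    then show ?thesis
      using that(1) dist_triangle[of x\<^sub>s "Z \<xi> p" \<xi>] unfolding len by (simp add: dist_norm norm_minus_commute)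
  qed
  \<comment> \<open>The \<open>m + 1\<close> flow steps of length at most \<open>\<kappa>\<close> use up only \<open>\<gamma> / 2\<close>, which leaves a margin of \<open>\<gamma> / 2\<close> in the ball of
    radius \<open>3 \<gamma>\<close>.\<close>
  have F_near: "F \<xi> t p \<in> cball x\<^sub>s (5 / 2 * \<gamma>)" if "\<xi> \<in> cball x\<^sub>s (2 * \<gamma>)" "p \<in> Q" "t \<in> {0..T}" for \<xi> t p
  proof -
    have "Z \<xi> p \<in> K" using Z_near[OF that(1,2)] \<kappa> \<open>\<gamma> > 0\<close> by (simp add: K_def algebra_simps)
    then have "norm (F \<xi> t p - Z \<xi> p) \<le> \<kappa>" unfolding F_def using that(3) by (intro G0) auto
    then have "dist x\<^sub>s (F \<xi> t p) \<le> 2 * \<gamma> + m * \<kappa> + \<kappa>"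
      using Z_near[OF that(1,2)] dist_triangle[of x\<^sub>s "F \<xi> t p" "Z \<xi> p"] by (simp add: dist_norm norm_minus_commute)
    then show ?thesis using \<kappa>(2) by (simp add: algebra_simps)
  qed
  have F_K: "F \<xi> t p \<in> K" if "\<xi> \<in> cball x\<^sub>s (2 * \<gamma>)" "p \<in> Q" "t \<in> {0..T}" for \<xi> t p
    using F_near[OF that] \<open>\<gamma> > 0\<close> by (simp add: K_def)

  have u_Q: "u t \<xi> \<in> Q" if "0 \<le> t" for t \<xi>
    using I2_admissible that by (auto simp: admissible_perturbations_def Q_def)
  have u_0: "u 0 \<xi> = 0" for \<xi>
    using I2_admissible by (auto simp: admissible_perturbations_def)
  have y_F: "y t \<xi> = F \<xi> t (u t \<xi>)" if "\<xi> \<in> cball x\<^sub>s (2 * \<gamma>)" "t \<in> {0..T}" for t \<xi>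
    using y_def[OF that(2,1)] by (simp add: F_def Z_def)

  note rep = assms(15)[unfolded gradient_representation_def, folded Q_def]
  have A_cont: "continuous_on Q (\<lambda>p. A p $ i $ j)" for i j
  proof -
    have "continuous_on Q (\<lambda>p. column j (A p))"
      using rep C_infinity_on_imp_continuous_on by blast
    then have "continuous_on Q (\<lambda>p. column j (A p) $ i)" by (rule continuous_on_component)
    then show ?thesis by (simp add: column_def)
  qed
  have Z_der: "((\<lambda>s. Z \<xi> (\<chi> i. if i = j then s else p $ i)) has_vector_derivative
      (\<Sum>i\<in>UNIV. A p $ i $ j *\<^sub>R g i (Z \<xi> p))) (at (p $ j) within {- a $ j..a $ j})"
    if "\<xi> \<in> cball x\<^sub>s (2 * \<gamma>)" "p \<in> Q" for \<xi> p j
    using rep that unfolding Z_def by blast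

  have F_der: "((\<lambda>s. F \<xi> t (\<chi> i. if i = j then s else p $ i)) has_vector_derivative
      (\<Sum>i\<in>UNIV. A p $ i $ j *\<^sub>R g i (F \<xi> t p))) (at (p $ j) within {(- a) $ j..a $ j})"
    if \<xi>: "\<xi> \<in> cball x\<^sub>s (2 * \<gamma>)" and "p \<in> Q" and "t \<in> {0..T}" for \<xi> t p j
  proof -
    \<comment> \<open>The coefficients are those at the base point \<open>p\<close>, so that \<open>X\<close> commutes with \<open>g\<^sub>0\<close>.\<close>
    define X where "X x = (\<Sum>i\<in>UNIV. A p $ i $ j *\<^sub>R g i x)" for x
    define z where "z s = Z \<xi> (\<chi> i. if i = j then s else p $ i)" for s
    have zp: "z (p $ j) = Z \<xi> p"
    proof -
      have "(\<chi> i. if i = j then p $ j else p $ i) = p" by (simp add: vec_eq_iff)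
      then show ?thesis by (simp add: z_def)
    qed
    have "((\<lambda>s. G\<^sub>0 t (z s)) has_vector_derivative X (G\<^sub>0 t (z (p $ j)))) (at (p $ j) within {- a $ j..a $ j})"
    proof (rule commuting_flow_transports_derivative[OF g0_C1 assms(3)])
      show "Ck_on 1 UNIV X" unfolding X_def by (intro C1_linear_combination g_C1)
      show "0 \<le> t" using that by simp
      show "5 / 2 * \<gamma> < 3 * \<gamma>" using \<open>\<gamma> > 0\<close> by simp
      show "G\<^sub>0 s (z (p $ j)) \<in> cball x\<^sub>s (5 / 2 * \<gamma>)" if "s \<in> {0..t}" for s
        using F_near[OF \<xi> \<open>p \<in> Q\<close>, of s] that \<open>t \<in> {0..T}\<close> by (simp add: F_def zp)
      show "G\<^sub>0 s (z r) \<in> cball x\<^sub>s (3 * \<gamma>)" if "r \<in> {- a $ j..a $ j}" "s \<in> {0..t}" for r s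
      proof -
        have "(\<chi> i. if i = j then r else p $ i) \<in> Q" using that(1) \<open>p \<in> Q\<close> by (auto simp: Q)
        then show ?thesis
          using F_K[OF \<xi>, of _ s] that \<open>t \<in> {0..T}\<close> by (simp add: F_def z_def K_def)
      qed
      show "lie_bracket g\<^sub>0 X (G\<^sub>0 s (z (p $ j))) = 0" if "s \<in> {0..t}" for s
      proof -
        have "G\<^sub>0 s (z (p $ j)) \<in> cball x\<^sub>s (3 * \<gamma>)"
          using F_K[OF \<xi> \<open>p \<in> Q\<close>, of s] that \<open>t \<in> {0..T}\<close> by (simp add: F_def zp K_def)
        then show ?thesis
          unfolding X_def lie_bracket_linear_combination[OF g0_C1 g_C1] by (simp add: I1_commute)
      qed
      show "(z has_vector_derivative X (z (p $ j))) (at (p $ j) within {- a $ j..a $ j})"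
        using Z_der[OF \<xi> \<open>p \<in> Q\<close>, of j] unfolding zp unfolding X_def z_def .
    qed
    then show ?thesis unfolding zp by (simp add: X_def z_def F_def)
  qed
  have F_time: "((\<lambda>t. F \<xi> t p) has_vector_derivative g\<^sub>0 (F \<xi> t p)) (at t within {0..T})" for \<xi> t p
    using assms(3) unfolding F_def is_flow_def by (blast intro: has_vector_derivative_at_within)
  have K_compact: "compact K" by (simp add: K_def)
  note g0_cont = Ck_on_1_UNIV_derivative(3)[OF g0_C1] and g_cont = Ck_on_1_UNIV_derivative(3)[OF g_C1]
  have F_cont: "continuous_on ({0..T} \<times> Q) (\<lambda>(t, p). F \<xi> t p)"
    and F_expansion: "e > 0 \<Longrightarrow> \<exists>\<delta>>0. \<forall>s\<in>{0..T}. \<forall>t\<in>{0..T}. \<forall>p\<in>Q. \<forall>q\<in>Q.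
      \<bar>t - s\<bar> < \<delta> \<and> norm (q - p) < \<delta> \<longrightarrow>
      norm (F \<xi> t q - F \<xi> s p - (t - s) *\<^sub>R g\<^sub>0 (F \<xi> s p) -
        (\<Sum>j\<in>UNIV. (q $ j - p $ j) *\<^sub>R (\<Sum>i\<in>UNIV. A p $ i $ j *\<^sub>R g i (F \<xi> s p))))
      \<le> e * (\<bar>t - s\<bar> + (\<Sum>j\<in>UNIV. \<bar>q $ j - p $ j\<bar>))"
    if \<xi>: "\<xi> \<in> cball x\<^sub>s (2 * \<gamma>)" for \<xi> e
    by (rule uniform_expansion_on_box[where l="- a" and v=a and F="F \<xi>" and k=g and K=K
          and B="\<lambda>i j p. A p $ i $ j", folded Q_def, OF F_time F_der[OF \<xi>] K_compact F_K[OF \<xi>] g0_cont g_cont A_cont];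
        assumption)+

  have \<tau>: "\<tau> 0 = 0" "\<tau> N = T" "\<And>k. k < N \<Longrightarrow> \<tau> k \<le> \<tau> (Suc k)"
      "\<And>k \<xi>. k < N \<Longrightarrow> continuous_on {\<tau> k..<\<tau> (Suc k)} (\<lambda>t. u t \<xi>)"
    using assms(16) by (auto simp: continuity_partition_def intro: less_imp_le)
  have \<tau>_ge: "0 \<le> \<tau> k" "\<tau> k \<le> T" if "k \<le> N" for k
    using partition_mono[of N \<tau> 0 k] partition_mono[of N \<tau> k N] that \<tau>(1-3) by auto

  have equation: "satisfies_differential_equation_on {\<tau> k..<\<tau> (Suc k)} g\<^sub>0 g (\<lambda>i t. beta A u i t \<xi>) (\<lambda>t. y t \<xi>)"
    if \<xi>: "\<xi> \<in> cball x\<^sub>s (2 * \<gamma>)" and "k < N" for \<xi> k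
    unfolding satisfies_differential_equation_on_def
  proof (intro allI impI)
    fix c d assume cd: "c \<le> d \<and> {c..d} \<subseteq> {\<tau> k..<\<tau> (Suc k)}"
    then have "\<tau> k \<le> c" "c \<le> d" "d < \<tau> (Suc k)" by auto
    then have c0: "0 \<le> c" and dT: "d < T"
      using \<tau>_ge(1)[of k] \<tau>_ge(2)[of "Suc k"] \<open>k < N\<close> by auto
    define U where "U j t = u t \<xi> $ j" for j t
    define h where "h i j t = A (u t \<xi>) $ i $ j" for i j t
    have h_cont: "continuous_on S (h i j)" if "continuous_on S (\<lambda>t. u t \<xi>)" "S \<subseteq> {0..}" for S i j
      unfolding h_def using u_Q that by (intro continuous_on_compose2[OF A_cont that(1)]) auto
    have u_cd: "continuous_on {c..d} (\<lambda>t. u t \<xi>)"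
      using continuous_on_subset[OF \<tau>(4)[OF \<open>k < N\<close>]] cd by blast
    have y_F': "y t \<xi> = F \<xi> t (u t \<xi>)" if "t \<in> {c..d}" for t
      using that c0 dT by (intro y_F \<xi>) auto
    have F_u: "continuous_on {c..d} (\<lambda>t. F \<xi> t (u t \<xi>))"
    proof -
      have "continuous_on {c..d} (\<lambda>t. case (t, u t \<xi>) of (t, p) \<Rightarrow> F \<xi> t p)"
        by (rule continuous_on_compose2[OF F_cont[OF \<xi>]])
          (use c0 dT u_Q in \<open>auto intro!: continuous_on_Pair u_cd\<close>)
      then show ?thesis by simp
    qed
    then have y_cont: "continuous_on {c..d} (\<lambda>t. y t \<xi>)"
      by (rule continuous_on_eq) (simp add: y_F')
    obtain M where M: "\<And>i j p. p \<in> Q \<Longrightarrow> \<bar>A p $ i $ j\<bar> \<le> M"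
    proof -
      have "continuous_on Q (\<lambda>p. \<chi> i j. A p $ i $ j)" by (intro continuous_intros A_cont)
      then have "bounded (A ` Q)"
        using compact_imp_bounded[OF compact_continuous_image[of Q A]] by (simp add: Q_def)
      then obtain M where M: "\<And>p. p \<in> Q \<Longrightarrow> norm (A p) \<le> M" unfolding bounded_iff by auto
      show ?thesis
      proof (rule that)
        show "\<bar>A p $ i $ j\<bar> \<le> M" if "p \<in> Q" for i j p
          using component_le_norm_cart[of "A p $ i" j] Finite_Cartesian_Product.norm_nth_le[of "A p" i] M[OF that] by linarith
      qed
    qed
    have U_rc: "right_continuous_bv (U j) 0 d" for j
      unfolding right_continuous_bv_def
    proof (intro conjI ballI)
      show "bounded_variation_on (U j) 0 d"
        unfolding U_def[abs_def]
        by (rule bounded_variation_on_subinterval[OF I2_variation]) (use c0 \<open>c \<le> d\<close> dT in auto)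
      fix t assume t: "t \<in> {0..<d}"
      then obtain l where l: "l < N" "\<tau> l \<le> t" "t < \<tau> (Suc l)"
        using partition_cell[of \<tau> t N] \<tau>(1,2) dT by auto
      then obtain r where r: "t < r" "r < \<tau> (Suc l)" using dense by blast
      have "continuous_on {t..r} (U j)"
        unfolding U_def[abs_def]
        using l r by (intro continuous_on_component continuous_on_subset[OF \<tau>(4)[OF l(1)]]) auto
      then have "continuous (at t within {t..r}) (U j)"
        using r by (simp add: continuous_on_eq_continuous_within)
      then show "continuous (at_right t) (U j)"
        using r(1) by (simp add: continuous_within at_within_Icc_at_right)
    qed
    have h_meas: "set_borel_measurable borel {0<..d} (h i j)" for i j
    proof (rule set_borel_measurable_subset)
      show "set_borel_measurable borel {\<tau> 0..<\<tau> N} (h i j)"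
      proof (rule set_borel_measurable_piecewise_continuous)
        show "continuous_on {\<tau> l..<\<tau> (Suc l)} (h i j)" if "l < N" for l
          using \<tau>_ge(1)[of l] that by (intro h_cont \<tau>(4)) auto
      qed (rule \<tau>(3))
    qed (use \<tau>(1,2) dT in auto)
    have expansion: "\<exists>\<delta>>0. \<forall>s t. c \<le> s \<and> s \<le> t \<and> t \<le> d \<and> t - s < \<delta> \<longrightarrow>
        norm (y t \<xi> - y s \<xi> - (t - s) *\<^sub>R g\<^sub>0 (y s \<xi>) - (\<Sum>j\<in>UNIV. (U j t - U j s) *\<^sub>R (\<Sum>i\<in>UNIV. h i j s *\<^sub>R g i (y s \<xi>))))
        \<le> e * (t - s + (\<Sum>j\<in>UNIV. \<bar>U j t - U j s\<bar>))" if "e > 0" for e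
    proof -
      obtain \<delta> where "\<delta> > 0" and \<delta>: "\<And>s t p q. s \<in> {0..T} \<Longrightarrow> t \<in> {0..T} \<Longrightarrow> p \<in> Q \<Longrightarrow> q \<in> Q \<Longrightarrow>
          \<bar>t - s\<bar> < \<delta> \<Longrightarrow> norm (q - p) < \<delta> \<Longrightarrow>
          norm (F \<xi> t q - F \<xi> s p - (t - s) *\<^sub>R g\<^sub>0 (F \<xi> s p) -
            (\<Sum>j\<in>UNIV. (q $ j - p $ j) *\<^sub>R (\<Sum>i\<in>UNIV. A p $ i $ j *\<^sub>R g i (F \<xi> s p))))
          \<le> e * (\<bar>t - s\<bar> + (\<Sum>j\<in>UNIV. \<bar>q $ j - p $ j\<bar>))"
        using F_expansion[OF \<xi> \<open>e > 0\<close>] by blast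
      obtain \<delta>' where "\<delta>' > 0" and \<delta>': "\<And>s t. c \<le> s \<Longrightarrow> s \<le> t \<Longrightarrow> t \<le> d \<Longrightarrow> t - s < \<delta>' \<Longrightarrow>
          dist (u t \<xi>) (u s \<xi>) \<le> \<delta> / 2"
        using continuous_on_interval_modulus[OF u_cd, of "\<delta> / 2"] \<open>\<delta> > 0\<close> by auto
      have "norm (y t \<xi> - y s \<xi> - (t - s) *\<^sub>R g\<^sub>0 (y s \<xi>) - (\<Sum>j\<in>UNIV. (U j t - U j s) *\<^sub>R (\<Sum>i\<in>UNIV. h i j s *\<^sub>R g i (y s \<xi>))))
          \<le> e * (t - s + (\<Sum>j\<in>UNIV. \<bar>U j t - U j s\<bar>))"
        if st: "c \<le> s" "s \<le> t" "t \<le> d" "t - s < min \<delta> \<delta>'" for s t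
      proof -
        have "norm (u t \<xi> - u s \<xi>) < \<delta>" using \<delta>'[of s t] st \<open>\<delta> > 0\<close> by (simp add: dist_norm)
        then show ?thesis
          using \<delta>[of s t "u s \<xi>" "u t \<xi>"] st c0 dT u_Q y_F'[of s] y_F'[of t] by (simp add: U_def h_def)
      qed
      then show ?thesis using \<open>\<delta> > 0\<close> \<open>\<delta>' > 0\<close> by (intro exI[of _ "min \<delta> \<delta>'"]) auto
    qed
    have g_y: "continuous_on {c..d} (\<lambda>t. f (y t \<xi>))" if "continuous_on UNIV f" for f :: "real^'n \<Rightarrow> real^'n"
      by (rule continuous_on_compose2[OF that y_cont]) auto
    have \<beta>: "beta A u i t \<xi> = (\<Sum>j\<in>UNIV. LS_integral (h i j) (U j) 0 t)" for i t
      by (simp add: beta_def alpha_def h_def[abs_def] U_def[abs_def])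
    note sol = LS_equation_from_expansion[where c=c and d=d and U=U and h=h and M=M and
        k\<^sub>0="\<lambda>t. g\<^sub>0 (y t \<xi>)" and k="\<lambda>i t. g i (y t \<xi>)" and y="\<lambda>t. y t \<xi>" and \<beta>="\<lambda>i t. beta A u i t \<xi>",
        OF c0 \<open>c \<le> d\<close> U_rc h_meas _ _ g_y[OF g0_cont] g_y[OF g_cont] \<beta> expansion]
    have hb: "\<bar>h i j t\<bar> \<le> M" if "t \<in> {0<..d}" for i j t
      unfolding h_def using that by (intro M u_Q) auto
    have hc: "continuous_on {c..d} (h i j)" for i j
      using c0 by (intro h_cont u_cd) auto
    show "set_integrable lborel {c..d} (\<lambda>s. g\<^sub>0 (y s \<xi>)) \<and>
        (\<forall>i. LS_integrable (\<lambda>s. g i (y s \<xi>)) (\<lambda>t. beta A u i t \<xi>) c d) \<and>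
        y d \<xi> - y c \<xi> = set_lebesgue_integral lborel {c..d} (\<lambda>s. g\<^sub>0 (y s \<xi>)) +
          (\<Sum>i\<in>UNIV. LS_integral (\<lambda>s. g i (y s \<xi>)) (\<lambda>t. beta A u i t \<xi>) c d)"
      by (intro conjI allI sol hb hc)
  qed
  have "y t \<xi> \<in> cball x\<^sub>s (3 * \<gamma>)" if "t \<in> {0..T}" "\<xi> \<in> cball x\<^sub>s (2 * \<gamma>)" for t \<xi>
    using F_K[OF that(2) u_Q that(1)] that y_F by (simp add: K_def)
  moreover have "y 0 \<xi> = \<xi>" if "\<xi> \<in> cball x\<^sub>s (2 * \<gamma>)" for \<xi>
    using y_def[of 0 \<xi>] that \<open>T > 0\<close> u_0 rep assms(3) by (simp add: is_flow_def)
  ultimately show ?thesis using equation by blast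
qed

end
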